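(* Let $V$ be a complex Hilbert space and let $g\in\mathrm{Sp}(V)$. The generalized Fock vacua for $g$ are precisely the nonzero scalar multiples of the Gaussian $$e^{Z_g}=\exp(\zeta_g)\in SV'.$$
   Context: $V$ is a complex Hilbert space with inner product $\langle\cdot|\cdot\rangle$ (antilinear in the first slot, linear in the second) and complex structure $J = i\,\cdot$. $\mathbb N=\{0,1,2,\dots\}$. $SV=\bigoplus_{d\in\mathbb N}S^dV$ is the (algebraic) symmetric algebra. $SV'$ is the space of all antilinear functionals $SV\to\mathbb C$ (no boundedness required). Product in $SV'$: let $\Delta:SV\to SV\otimes SV$ be the algebra homomorphism with $\Delta(v)=v\otimes 1+1\otimes v$ for $v\in V$; for $\Phi,\Psi\in SV'$ put $[\Phi\Psi](\theta)=[\Phi\otimes\Psi](\Delta\theta)$, where $[\Phi\otimes\Psi](\xi\otimes\eta)=\Phi(\xi)\Psi(\eta)$. This makes $SV'$ a commutative associative algebra. Creators and annihilators: for $v\in V$, $c(v):SV\to SV$ is multiplication by $v$, and $a(v):SV\to SV$ is the unique linear derivation with $a(v)1=0$ and $a(v)w=\langle v|w\rangle$ for $w\in V$. They extend to $SV'$ by $[c(v)\Phi](\psi)=\Phi(a(v)\psi)$ and $[a(v)\Phi](\psi)=\Phi(c(v)\psi)$ for $\Phi\in SV'$, $\psi\in SV$. On $SV$ and on $SV'$ put $\pi(v)=\frac1{\sqrt2}\{c(v)+a(v)\}$. Symplectic group: $\Omega=\mathrm{Im}\langle\cdot|\cdot\rangle$; $\mathrm{Sp}(V)$ is the group of real-linear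 automorphisms $g$ of $V$ with $\Omega(gx,gy)=\Omega(x,y)$ for all $x,y\in V$. Put $C_g=\frac12(g-JgJ)$ (complex-linear) and $A_g=\frac12(g+JgJ)$ (antilinear), so $g=C_g+A_g$. $C_g$ is invertible, and $Z_g=-A_gC_g^{-1}$ is an antilinear operator on $V$ that is symmetric ($\langle y|Z_gx\rangle=\langle x|Z_gy\rangle$) with operator norm $<1$. For $v \in V$ put $a_g(v)=a(C_gv)+c(A_gv)$. Gaussian: $\zeta_g\in SV'$ vanishes on $S^dV$ for $d\ne2$ and satisfies $\zeta_g(xy)=\langle y|Z_gx\rangle$ for $x,y\in V$. Then $\exp(\zeta_g)=\sum_{n\in\mathbb N}\zeta_g^n/n!\in SV'$ (when evaluated on any element of $SV$ the sum is finite). A generalized Fock vacuum for $g\in\mathrm{Sp}(V)$ is a nonzero $\Phi\in SV'$ such that $\{\pi(gv)+i\pi(gJv)\}\Phi=0$ for all $v\in V$; equivalently, $a_g(v)\Phi=0$ for all $v\in V$. *)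

theory Defs
  imports Complex_Main "HOL-Library.Multiset" "HOL-Library.Poly_Mapping"
begin

section \<open>Complex vector spaces, Hilbert spaces and commutative algebras\<close>

class complex_vector = ab_group_add +
  fixes scaleC :: "complex \<Rightarrow> 'a \<Rightarrow> 'a" (infixr "*\<^sub>C" 75)
  assumes scaleC_add_right: "a *\<^sub>C (x + y) = a *\<^sub>C x + a *\<^sub>C y"
    and scaleC_add_left: "(a + b) *\<^sub>C x = a *\<^sub>C x + b *\<^sub>C x"
    and scaleC_scaleC: "a *\<^sub>C (b *\<^sub>C x) = (a * b) *\<^sub>C x"
    and scaleC_one: "1 *\<^sub>C x = x"

global_interpretation cvec: vector_space "scaleC :: complex \<Rightarrow> 'a \<Rightarrow> 'a::complex_vector"
  by standard (fact scaleC_add_right scaleC_add_left scaleC_scaleC scaleC_one)+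

abbreviation cspan :: "'a::complex_vector set \<Rightarrow> 'a set"
  where "cspan \<equiv> module.span (*\<^sub>C)"

abbreviation clinear :: "('a::complex_vector \<Rightarrow> 'b::complex_vector) \<Rightarrow> bool"
  where "clinear \<equiv> Vector_Spaces.linear (*\<^sub>C) (*\<^sub>C)"

definition antilinear :: "('a::complex_vector \<Rightarrow> complex) \<Rightarrow> bool" where
  "antilinear f \<longleftrightarrow> (\<forall>x y. f (x + y) = f x + f y) \<and> (\<forall>c x. f (c *\<^sub>C x) = cnj c * f x)"

text \<open>Completeness comes from \<^class>\<open>banach\<close>; the last axiom says that its norm is the
  Hilbert space norm, so the inner product is positive definite.\<close>

class complex_hilbert = banach + complex_vector +
  fixes cinner :: "'a \<Rightarrow> 'a \<Rightarrow> complex"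
  assumes scaleR_eq_scaleC: "r *\<^sub>R x = of_real r *\<^sub>C x"
    and cinner_add_right: "cinner x (y + z) = cinner x y + cinner x z"
    and cinner_scaleC_right: "cinner x (c *\<^sub>C y) = c * cinner x y"
    and cinner_commute: "cinner y x = cnj (cinner x y)"
    and cinner_self: "cinner x x = of_real ((norm x)\<^sup>2)"

text \<open>The axiom \<open>0 \<noteq> 1\<close> is not imposed.\<close>

class complex_comm_algebra = complex_vector + comm_ring + comm_monoid_mult +
  assumes scaleC_mult_left: "(c *\<^sub>C x) * y = c *\<^sub>C (x * y)"

lemma scaleC_mult_right: "x * (c *\<^sub>C y) = c *\<^sub>C (x * y)" for x :: "'a::complex_comm_algebra"
  by (metis mult.commute scaleC_mult_left)

instantiation complex :: complex_comm_algebra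
begin
definition scaleC_complex :: "complex \<Rightarrow> complex \<Rightarrow> complex" where
  "scaleC_complex c z = c * z"
instance by standard (simp_all add: scaleC_complex_def algebra_simps)
end

lemma clinearI:
  assumes "\<And>x y. f (x + y) = f x + f y" "\<And>c x. f (c *\<^sub>C x) = c *\<^sub>C f x"
  shows "clinear f"
  by (simp add: assms linear_iff_module_hom module_hom_def module_hom_axioms_def
      cvec.module_axioms)

lemma clinear_add: "clinear f \<Longrightarrow> f (x + y) = f x + f y"
  and clinear_scaleC: "clinear f \<Longrightarrow> f (c *\<^sub>C x) = c *\<^sub>C f x"
  by (simp_all add: linear_iff_module_hom module_hom.add module_hom.scale)

lemma clinear_0: "clinear f \<Longrightarrow> f 0 = 0"
  by (metis cvec.scale_zero_left clinear_scaleC)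

lemma clinear_diff: "clinear f \<Longrightarrow> f (x - y) = f x - f y"
  by (metis add_diff_cancel diff_add_cancel clinear_add)

lemma clinear_sum: "clinear f \<Longrightarrow> f (sum h A) = (\<Sum>a\<in>A. f (h a))"
  by (induction A rule: infinite_finite_induct) (simp_all add: clinear_0 clinear_add)

lemma clinear_comp: "clinear f \<Longrightarrow> clinear g \<Longrightarrow> clinear (\<lambda>x. f (g x))"
  by (rule clinearI) (simp_all add: clinear_add clinear_scaleC)


section \<open>Free vector spaces\<close>

text \<open>\<open>'k \<Rightarrow>\<^sub>0 complex\<close> is the complex vector space with basis \<open>'k\<close>, the basis vectors being
  \<open>Poly_Mapping.single k 1\<close>.\<close>

instantiation poly_mapping :: (type, complex_vector) complex_vector
begin

lift_definition scaleC_poly_mapping :: "complex \<Rightarrow> ('a \<Rightarrow>\<^sub>0 'b) \<Rightarrow> ('a \<Rightarrow>\<^sub>0 'b)"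
  is "\<lambda>c f k. c *\<^sub>C f k"
  by (erule finite_subset[rotated]) auto

instance
  by standard (transfer; simp add: fun_eq_iff scaleC_add_right scaleC_add_left)+

end

lemma lookup_scaleC: "Poly_Mapping.lookup (c *\<^sub>C f) k = c *\<^sub>C Poly_Mapping.lookup f k"
  by transfer simp

definition free_lift :: "('k \<Rightarrow> 'b::complex_vector) \<Rightarrow> ('k \<Rightarrow>\<^sub>0 complex) \<Rightarrow> 'b" where
  "free_lift h f = (\<Sum>k\<in>Poly_Mapping.keys f. Poly_Mapping.lookup f k *\<^sub>C h k)"

lemma free_lift_superset:
  assumes "finite K" "Poly_Mapping.keys f \<subseteq> K"
  shows "free_lift h f = (\<Sum>k\<in>K. Poly_Mapping.lookup f k *\<^sub>C h k)"
  unfolding free_lift_def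
  by (rule sum.mono_neutral_left) (use assms in \<open>auto simp: in_keys_iff\<close>)

lemma clinear_free_lift: "clinear (free_lift h)"
proof (rule clinearI)
  fix f g :: "'a \<Rightarrow>\<^sub>0 complex" and c
  let ?K = "Poly_Mapping.keys f \<union> Poly_Mapping.keys g"
  have "Poly_Mapping.keys (f + g) \<subseteq> ?K" by (rule Poly_Mapping.keys_add)
  then show "free_lift h (f + g) = free_lift h f + free_lift h g"
    by (subst (1 2 3) free_lift_superset[where K = ?K])
       (auto simp: lookup_add scaleC_add_left sum.distrib)
  have "Poly_Mapping.keys (c *\<^sub>C f) \<subseteq> Poly_Mapping.keys f"
    by (auto simp: in_keys_iff lookup_scaleC)
  then show "free_lift h (c *\<^sub>C f) = c *\<^sub>C free_lift h f"
    by (subst (1 2) free_lift_superset[where K = "Poly_Mapping.keys f"])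
       (auto simp: lookup_scaleC cvec.scale_sum_right scaleC_complex_def)
qed

lemma free_lift_single [simp]: "free_lift h (Poly_Mapping.single k c) = c *\<^sub>C h k"
  by (cases "c = 0") (simp_all add: free_lift_def)

lemma free_induct [case_names zero add single]:
  assumes "P 0" "\<And>f g. P f \<Longrightarrow> P g \<Longrightarrow> P (f + g)" "\<And>k c. P (Poly_Mapping.single k c)"
  shows "P (f :: 'k \<Rightarrow>\<^sub>0 complex)"
proof (induction f rule: Poly_Mapping.update_induct)
  case const
  then show ?case by (rule assms(1))
next
  case (update f k c)
  have "Poly_Mapping.update k c f = f + Poly_Mapping.single k c"
    using update(1)
    by (intro poly_mapping_eqI)
       (auto simp: lookup_update lookup_add lookup_single in_keys_iff when_def)
  then show ?case using update assms by simp
qed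

lemma scaleC_single: "c *\<^sub>C Poly_Mapping.single k d = Poly_Mapping.single k (c * d :: complex)"
  by (intro poly_mapping_eqI) (simp add: lookup_scaleC lookup_single when_def scaleC_complex_def)

lemma free_lift_eqI:
  assumes "clinear F" "\<And>k. F (Poly_Mapping.single k 1) = h k"
  shows "F f = free_lift h f"
proof (induction f rule: free_induct)
  case (single k c)
  have "F (c *\<^sub>C Poly_Mapping.single k 1) = c *\<^sub>C h k"
    by (simp only: clinear_scaleC[OF assms(1)] assms(2))
  then show ?case by (simp add: scaleC_single)
qed (simp_all add: clinear_add[OF assms(1)] clinear_0[OF assms(1)]
      clinear_add[OF clinear_free_lift] clinear_0[OF clinear_free_lift])


section \<open>Tensor products\<close>

definition tensor_relators :: "('a::complex_vector \<times> 'b::complex_vector \<Rightarrow>\<^sub>0 complex) set" where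
  "tensor_relators =
     {Poly_Mapping.single (x + x', y) 1 - Poly_Mapping.single (x, y) 1
        - Poly_Mapping.single (x', y) 1 | x x' y. True}
   \<union> {Poly_Mapping.single (x, y + y') 1 - Poly_Mapping.single (x, y) 1
        - Poly_Mapping.single (x, y') 1 | x y y'. True}
   \<union> {Poly_Mapping.single (c *\<^sub>C x, y) 1 - Poly_Mapping.single (x, y) c | c x y. True}
   \<union> {Poly_Mapping.single (x, c *\<^sub>C y) 1 - Poly_Mapping.single (x, y) c | c x y. True}"

definition tensor_rel ::
  "('a::complex_vector \<times> 'b::complex_vector \<Rightarrow>\<^sub>0 complex) \<Rightarrow> ('a \<times> 'b \<Rightarrow>\<^sub>0 complex) \<Rightarrow> bool" where
  "tensor_rel f g \<longleftrightarrow> f - g \<in> cspan tensor_relators"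

lemma tensor_rel_trans: "tensor_rel f g \<Longrightarrow> tensor_rel g h \<Longrightarrow> tensor_rel f h"
  unfolding tensor_rel_def using cvec.span_add[of "f - g" tensor_relators "g - h"] by simp

lemma equivp_tensor_rel: "equivp tensor_rel"
proof (rule equivpI)
  show "reflp tensor_rel" by (simp add: reflp_def tensor_rel_def cvec.span_zero)
  show "symp tensor_rel"
    unfolding symp_def tensor_rel_def by (metis cvec.span_neg minus_diff_eq)
  show "transp tensor_rel" unfolding transp_def using tensor_rel_trans by blast
qed

quotient_type (overloaded) ('a, 'b) tensor =
    "'a::complex_vector \<times> 'b::complex_vector \<Rightarrow>\<^sub>0 complex" / tensor_rel
  by (rule equivp_tensor_rel)

instantiation tensor :: (complex_vector, complex_vector) complex_vector
begin

lift_definition zero_tensor :: "('a, 'b) tensor" is 0 .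

lift_definition plus_tensor :: "('a, 'b) tensor \<Rightarrow> ('a, 'b) tensor \<Rightarrow> ('a, 'b) tensor" is "(+)"
  unfolding tensor_rel_def by (drule (1) cvec.span_add) (simp add: algebra_simps)

lift_definition uminus_tensor :: "('a, 'b) tensor \<Rightarrow> ('a, 'b) tensor" is uminus
  unfolding tensor_rel_def by (drule cvec.span_neg) (simp add: algebra_simps)

lift_definition minus_tensor :: "('a, 'b) tensor \<Rightarrow> ('a, 'b) tensor \<Rightarrow> ('a, 'b) tensor" is "(-)"
  unfolding tensor_rel_def by (drule (1) cvec.span_diff) (simp add: algebra_simps)

lift_definition scaleC_tensor :: "complex \<Rightarrow> ('a, 'b) tensor \<Rightarrow> ('a, 'b) tensor" is scaleC
  unfolding tensor_rel_def by (drule cvec.span_scale) (simp add: cvec.scale_right_diff_distrib)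

instance
  by standard
     (transfer; simp add: tensor_rel_def cvec.span_zero scaleC_add_right scaleC_add_left)+

end

lift_definition tensor :: "'a::complex_vector \<Rightarrow> 'b::complex_vector \<Rightarrow> ('a, 'b) tensor"
    (infixl "\<otimes>\<^sub>t" 75)
  is "\<lambda>x y. Poly_Mapping.single (x, y) 1" .

text \<open>The linear map induced by a bilinear map \<open>h\<close>.\<close>

definition tensor_lift ::
  "('a::complex_vector \<Rightarrow> 'b::complex_vector \<Rightarrow> 'c::complex_vector) \<Rightarrow> ('a, 'b) tensor \<Rightarrow> 'c" where
  "tensor_lift h t = free_lift (\<lambda>(x, y). h x y) (rep_tensor t)"

lemma tensor_add_left: "(x + x') \<otimes>\<^sub>t y = x \<otimes>\<^sub>t y + x' \<otimes>\<^sub>t y"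
  by transfer
     (unfold tensor_rel_def tensor_relators_def diff_diff_eq[symmetric] scaleC_single mult_1_right,
      rule cvec.span_base, blast)

lemma tensor_add_right: "x \<otimes>\<^sub>t (y + y') = x \<otimes>\<^sub>t y + x \<otimes>\<^sub>t y'"
  by transfer
     (unfold tensor_rel_def tensor_relators_def diff_diff_eq[symmetric] scaleC_single mult_1_right,
      rule cvec.span_base, blast)

lemma tensor_scaleC_left: "(c *\<^sub>C x) \<otimes>\<^sub>t y = c *\<^sub>C (x \<otimes>\<^sub>t y)"
  by transfer
     (unfold tensor_rel_def tensor_relators_def diff_diff_eq[symmetric] scaleC_single mult_1_right,
      rule cvec.span_base, blast)

lemma tensor_scaleC_right: "x \<otimes>\<^sub>t (c *\<^sub>C y) = c *\<^sub>C (x \<otimes>\<^sub>t y)"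
  by transfer
     (unfold tensor_rel_def tensor_relators_def diff_diff_eq[symmetric] scaleC_single mult_1_right,
      rule cvec.span_base, blast)

lemma tensor_induct [case_names pure add, induct type: tensor]:
  assumes "\<And>x y. P (x \<otimes>\<^sub>t y)" "\<And>s t. P s \<Longrightarrow> P t \<Longrightarrow> P (s + t)"
  shows "P t"
proof -
  have 0: "(0 :: ('a, 'b) tensor) = 0 \<otimes>\<^sub>t 0"
    using tensor_scaleC_left[of 0 0 "0 :: 'b"] by simp
  have "P (abs_tensor f)" for f
  proof (induction f rule: free_induct)
    case zero
    then show ?case using assms(1)[of 0 0] 0 by (simp add: zero_tensor.abs_eq)
  next
    case (add f g)
    then show ?case using assms(2) by (simp flip: plus_tensor.abs_eq)
  next
    case (single k c)
    have "abs_tensor (c *\<^sub>C Poly_Mapping.single k 1) = (c *\<^sub>C fst k) \<otimes>\<^sub>t snd k"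
      unfolding tensor_scaleC_left
      by (simp add: tensor.abs_eq flip: scaleC_tensor.abs_eq)
    then show ?case using assms(1) by (simp add: scaleC_single)
  qed
  then show ?thesis by (metis Quotient3_abs_rep Quotient3_tensor)
qed

definition cbilinear ::
  "('a::complex_vector \<Rightarrow> 'b::complex_vector \<Rightarrow> 'c::complex_vector) \<Rightarrow> bool" where
  "cbilinear h \<longleftrightarrow> (\<forall>x. clinear (h x)) \<and> (\<forall>y. clinear (\<lambda>x. h x y))"

lemma tensor_lift_abs:
  assumes "cbilinear h"
  shows "tensor_lift h (abs_tensor f) = free_lift (\<lambda>(x, y). h x y) f"
proof -
  let ?L = "free_lift (\<lambda>(x, y). h x y)"
  note L = clinear_free_lift[of "\<lambda>(x, y). h x y"]
  have r: "clinear (h x)" and l: "clinear (\<lambda>x. h x y)" for x y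
    using assms by (auto simp: cbilinear_def)
  have "?L z = 0" if "z \<in> cspan tensor_relators" for z
    using that
  proof (induction rule: cvec.span_induct_alt)
    case (step c x y)
    then have "?L x = 0"
      unfolding tensor_relators_def
      by (auto simp: clinear_diff[OF L] scaleC_one clinear_add[OF r] clinear_scaleC[OF r]
          clinear_add[OF l] clinear_scaleC[OF l])
    then show ?case using step by (simp add: clinear_add[OF L] clinear_scaleC[OF L])
  qed (simp add: clinear_0[OF L])
  moreover have "tensor_rel (rep_tensor (abs_tensor f)) f"
    by (simp add: Quotient3_tensor rep_abs_rsp_left equivp_reflp[OF equivp_tensor_rel])
  ultimately have "?L (rep_tensor (abs_tensor f) - f) = 0"
    by (simp add: tensor_rel_def)
  then show ?thesis by (simp add: tensor_lift_def clinear_diff[OF L])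
qed

lemma tensor_lift_pure [simp]: "cbilinear h \<Longrightarrow> tensor_lift h (x \<otimes>\<^sub>t y) = h x y"
  by (simp add: tensor.abs_eq tensor_lift_abs scaleC_one)

lemma clinear_tensor_lift:
  assumes "cbilinear h"
  shows "clinear (tensor_lift h)"
proof (rule clinearI)
  note L = clinear_free_lift[of "\<lambda>(x, y). h x y"]
  fix s t :: "('a, 'b) tensor" and c
  obtain f g where fg: "s = abs_tensor f" "t = abs_tensor g"
    by (metis Quotient3_abs_rep Quotient3_tensor)
  show "tensor_lift h (s + t) = tensor_lift h s + tensor_lift h t"
    by (simp add: fg plus_tensor.abs_eq tensor_lift_abs assms clinear_add[OF L])
  show "tensor_lift h (c *\<^sub>C s) = c *\<^sub>C tensor_lift h s"
    by (simp add: fg scaleC_tensor.abs_eq tensor_lift_abs assms clinear_scaleC[OF L])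
qed

lemma tensor_clinear_ext:
  assumes "clinear F" "clinear G" "\<And>x y. F (x \<otimes>\<^sub>t y) = G (x \<otimes>\<^sub>t y)"
  shows "F t = G t"
proof (induction t)
  case (pure x y)
  show ?case by (rule assms(3))
next
  case (add s t)
  then show ?case by (simp only: clinear_add[OF assms(1)] clinear_add[OF assms(2)])
qed

lemma cbilinearI:
  assumes "\<And>x y y'. h x (y + y') = h x y + h x y'" "\<And>x x' y. h (x + x') y = h x y + h x' y"
    and "\<And>c x y. h x (c *\<^sub>C y) = c *\<^sub>C h x y" "\<And>c x y. h (c *\<^sub>C x) y = c *\<^sub>C h x y"
  shows "cbilinear h"
  unfolding cbilinear_def
proof (rule conjI; rule allI)
  show "clinear (h x)" for x by (rule clinearI) (rule assms)+
  show "clinear (\<lambda>x. h x y)" for y by (rule clinearI) (rule assms)+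
qed

lemma cbilinear_tensor_times:
  "cbilinear (\<lambda>x y. (a * x) \<otimes>\<^sub>t (b * y))"
  for a :: "'a::complex_comm_algebra" and b :: "'b::complex_comm_algebra"
  by (rule cbilinearI)
     (simp_all only: distrib_left scaleC_mult_right tensor_add_left tensor_add_right
       tensor_scaleC_left tensor_scaleC_right)

lemma cbilinear_tensor_times':
  "cbilinear (\<lambda>a b. tensor_lift (\<lambda>x y. (a * x) \<otimes>\<^sub>t (b * y)) t)"
  for t :: "('a::complex_comm_algebra, 'b::complex_comm_algebra) tensor"
proof -
  define L where "L a b = tensor_lift (\<lambda>x y. (a * x) \<otimes>\<^sub>t (b * y))" for a :: 'a and b :: 'b
  have L_pure: "L a b (x \<otimes>\<^sub>t y) = (a * x) \<otimes>\<^sub>t (b * y)" for a x b y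
    unfolding L_def by (rule tensor_lift_pure[OF cbilinear_tensor_times])
  have L_add: "L a b (s + t) = L a b s + L a b t" for a b s t
    unfolding L_def by (rule clinear_add[OF clinear_tensor_lift[OF cbilinear_tensor_times]])
  have "cbilinear (\<lambda>a b. L a b t)"
  proof (rule cbilinearI)
    fix a a' :: 'a and b b' :: 'b and c
    show "L a (b + b') t = L a b t + L a b' t"
      by (induction t) (simp_all add: L_pure L_add distrib_right tensor_add_right)
    show "L (a + a') b t = L a b t + L a' b t"
      by (induction t) (simp_all add: L_pure L_add distrib_right tensor_add_left)
    show "L a (c *\<^sub>C b) t = c *\<^sub>C L a b t"
      by (induction t)
         (simp_all add: L_pure L_add scaleC_mult_left tensor_scaleC_right scaleC_add_right)
    show "L (c *\<^sub>C a) b t = c *\<^sub>C L a b t"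
      by (induction t)
         (simp_all add: L_pure L_add scaleC_mult_left tensor_scaleC_left scaleC_add_right)
  qed
  then show ?thesis by (simp add: L_def)
qed

text \<open>\<open>(a \<otimes>\<^sub>t b) * (x \<otimes>\<^sub>t y) = (a * x) \<otimes>\<^sub>t (b * y)\<close>, see \<open>tensor_times_pure\<close>.\<close>

instantiation tensor :: (complex_comm_algebra, complex_comm_algebra) complex_comm_algebra
begin

definition one_tensor :: "('a, 'b) tensor" where
  "one_tensor = 1 \<otimes>\<^sub>t 1"

definition times_tensor :: "('a, 'b) tensor \<Rightarrow> ('a, 'b) tensor \<Rightarrow> ('a, 'b) tensor" where
  "times_tensor s t = tensor_lift (\<lambda>a b. tensor_lift (\<lambda>x y. (a * x) \<otimes>\<^sub>t (b * y)) t) s"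

instance
proof
  fix r s t :: "('a, 'b) tensor" and c :: complex
  note C1 = clinear_tensor_lift[OF cbilinear_tensor_times']
  note C2 = clinear_tensor_lift[OF cbilinear_tensor_times]
  have addl: "(r + s) * t = r * t + s * t" for r s t :: "('a, 'b) tensor"
    by (simp add: times_tensor_def clinear_add[OF C1])
  have times_pure: "(a \<otimes>\<^sub>t b) * (x \<otimes>\<^sub>t y) = (a * x) \<otimes>\<^sub>t (b * y)" for a x :: 'a and b y :: 'b
    unfolding times_tensor_def tensor_lift_pure[OF cbilinear_tensor_times']
    by (rule tensor_lift_pure[OF cbilinear_tensor_times])
  have addr: "r * (s + t) = r * s + r * t" for r s t :: "('a, 'b) tensor"
  proof (induction r)
    case (pure x y)
    show ?case
      unfolding times_tensor_def tensor_lift_pure[OF cbilinear_tensor_times']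
      by (rule clinear_add[OF C2])
  qed (simp add: addl)
  show comm: "s * t = t * s" for s t :: "('a, 'b) tensor"
  proof (induction s)
    case (pure x y)
    then show ?case by (induction t) (simp_all add: times_pure addl addr mult.commute)
  qed (simp add: addl addr)
  show "(r + s) * t = r * t + s * t" by (rule addl)
  show "1 * t = t"
    by (induction t) (simp_all add: one_tensor_def times_pure addr)
  show "(c *\<^sub>C s) * t = c *\<^sub>C (s * t)"
    by (simp add: times_tensor_def clinear_scaleC[OF C1])
  show "(r * s) * t = r * (s * t)"
  proof (induction r)
    case r: (pure x y)
    show ?case
    proof (induction s)
      case s: (pure x' y')
      show ?case by (induction t) (simp_all add: times_pure addl addr mult.assoc)
    qed (simp add: addl addr)
  qed (simp add: addl)
qed

end

lemma tensor_times_pure: "(a \<otimes>\<^sub>t b) * (x \<otimes>\<^sub>t y) = (a * x) \<otimes>\<^sub>t (b * y)"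
  for a x :: "'a::complex_comm_algebra" and b y :: "'b::complex_comm_algebra"
  unfolding times_tensor_def tensor_lift_pure[OF cbilinear_tensor_times']
  by (rule tensor_lift_pure[OF cbilinear_tensor_times])


section \<open>The symmetric algebra\<close>

text \<open>With its convolution product, \<open>'v multiset \<Rightarrow>\<^sub>0 complex\<close> is the polynomial ring with one
  indeterminate \<open>Poly_Mapping.single {#v#} 1\<close> for each vector \<open>v\<close>. The symmetric algebra is its
  quotient by the ideal that makes the indeterminate depend linearly on \<open>v\<close>.\<close>

definition sym_relators :: "('v::complex_vector multiset \<Rightarrow>\<^sub>0 complex) set" where
  "sym_relators =
     {Poly_Mapping.single {#v + w#} 1 - Poly_Mapping.single {#v#} 1
        - Poly_Mapping.single {#w#} 1 | v w. True}
   \<union> {Poly_Mapping.single {#c *\<^sub>C v#} 1 - Poly_Mapping.single {#v#} c | c v. True}"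

text \<open>The span over the ring itself is the ideal generated by the relators.\<close>

definition sym_rel ::
  "('v::complex_vector multiset \<Rightarrow>\<^sub>0 complex) \<Rightarrow> ('v multiset \<Rightarrow>\<^sub>0 complex) \<Rightarrow> bool" where
  "sym_rel p q \<longleftrightarrow> p - q \<in> module.span (*) sym_relators"

lemma module_times: "module ((*) :: 'a::comm_ring_1 \<Rightarrow> 'a \<Rightarrow> 'a)"
  by standard (simp_all add: algebra_simps)

lemmas ideal_zero = module.span_zero[OF module_times]
  and ideal_add = module.span_add[OF module_times]
  and ideal_neg = module.span_neg[OF module_times]
  and ideal_diff = module.span_diff[OF module_times]
  and ideal_times = module.span_scale[OF module_times]
  and ideal_base = module.span_base[OF module_times]

lemmas ideal_induct =
  module.span_induct_alt[OF module_times, consumes 1, case_names base step]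

lemma sym_rel_trans: "sym_rel f g \<Longrightarrow> sym_rel g h \<Longrightarrow> sym_rel f h"
  unfolding sym_rel_def using ideal_add[of "f - g" sym_relators "g - h"] by simp

lemma equivp_sym_rel: "equivp sym_rel"
proof (rule equivpI)
  show "reflp sym_rel" by (simp add: reflp_def sym_rel_def ideal_zero)
  show "symp sym_rel"
    unfolding symp_def sym_rel_def by (metis ideal_neg minus_diff_eq)
  show "transp sym_rel" unfolding transp_def using sym_rel_trans by blast
qed

quotient_type (overloaded) 'v symalg = "'v::complex_vector multiset \<Rightarrow>\<^sub>0 complex" / sym_rel
  by (rule equivp_sym_rel)

lemma scaleC_eq_times: "c *\<^sub>C p = Poly_Mapping.single 0 c * p"
  for p :: "'k::comm_monoid_add \<Rightarrow>\<^sub>0 complex"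
  by (induction p rule: free_induct)
     (simp_all add: scaleC_add_right distrib_left scaleC_single mult_single)

instantiation symalg :: (complex_vector) complex_comm_algebra
begin

lift_definition zero_symalg :: "'a symalg" is 0 .

lift_definition one_symalg :: "'a symalg" is 1 .

lift_definition plus_symalg :: "'a symalg \<Rightarrow> 'a symalg \<Rightarrow> 'a symalg" is "(+)"
  unfolding sym_rel_def by (drule (1) ideal_add) (simp add: algebra_simps)

lift_definition uminus_symalg :: "'a symalg \<Rightarrow> 'a symalg" is uminus
  unfolding sym_rel_def by (drule ideal_neg) (simp add: algebra_simps)

lift_definition minus_symalg :: "'a symalg \<Rightarrow> 'a symalg \<Rightarrow> 'a symalg" is "(-)"
  unfolding sym_rel_def by (drule (1) ideal_diff) (simp add: algebra_simps)

lift_definition times_symalg :: "'a symalg \<Rightarrow> 'a symalg \<Rightarrow> 'a symalg" is "(*)"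
proof -
  fix p p' q q' :: "'a multiset \<Rightarrow>\<^sub>0 complex"
  assume "sym_rel p p'" "sym_rel q q'"
  then have "q * (p - p') + p' * (q - q') \<in> module.span (*) sym_relators"
    unfolding sym_rel_def by (intro ideal_add ideal_times)
  then show "sym_rel (p * q) (p' * q')"
    by (simp add: sym_rel_def algebra_simps)
qed

lift_definition scaleC_symalg :: "complex \<Rightarrow> 'a symalg \<Rightarrow> 'a symalg" is scaleC
  unfolding sym_rel_def scaleC_eq_times right_diff_distrib[symmetric] by (rule ideal_times)

instance
  by standard
     (transfer; simp add: sym_rel_def ideal_zero scaleC_add_right scaleC_add_left algebra_simps
       scaleC_eq_times[of _ "_ :: _ multiset \<Rightarrow>\<^sub>0 complex"] mult_single single_add)+

end

text \<open>The inclusion of \<open>V\<close> as the degree one part.\<close>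

lift_definition sym_gen :: "'v::complex_vector \<Rightarrow> 'v symalg" is
  "\<lambda>v. Poly_Mapping.single {#v#} 1" .

text \<open>The algebra homomorphism induced by a linear map \<open>f\<close>; see \<open>sym_lift_gen\<close>,
  \<open>sym_lift_times\<close> and \<open>sym_lift_unique\<close>.\<close>

definition sym_lift ::
  "('v::complex_vector \<Rightarrow> 'b::complex_comm_algebra) \<Rightarrow> 'v symalg \<Rightarrow> 'b" where
  "sym_lift f x = free_lift (\<lambda>m. \<Prod>v\<in>#m. f v) (rep_symalg x)"

text \<open>\<open>S\<^sup>dV\<close>\<close>

definition sym_degree :: "nat \<Rightarrow> 'v::complex_vector symalg set" where
  "sym_degree d = cspan {\<Prod>v\<in>#m. sym_gen v | m. size m = d}"

lemma clinear_sym_gen: "clinear sym_gen"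
proof (rule clinearI)
  show "sym_gen (v + w) = sym_gen v + sym_gen w" for v w :: 'a
    by transfer
       (unfold sym_rel_def sym_relators_def diff_diff_eq[symmetric], rule ideal_base, blast)
  show "sym_gen (c *\<^sub>C v) = c *\<^sub>C sym_gen v" for c and v :: 'a
    by transfer
       (unfold sym_rel_def sym_relators_def scaleC_single mult_1_right, rule ideal_base, blast)
qed

lemma symalg_abs_single:
  "abs_symalg (Poly_Mapping.single m c) = c *\<^sub>C (\<Prod>v\<in>#m. sym_gen v)"
proof -
  have "abs_symalg (Poly_Mapping.single m 1) = (\<Prod>v\<in>#m. sym_gen v)"
  proof (induction m)
    case empty
    then show ?case by (simp add: one_symalg.abs_eq)
  next
    case (add v m)
    have "abs_symalg (Poly_Mapping.single (add_mset v m) 1)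
        = abs_symalg (Poly_Mapping.single {#v#} 1 * Poly_Mapping.single m 1)"
      by (simp add: mult_single)
    then show ?case by (simp add: add sym_gen.abs_eq flip: times_symalg.abs_eq)
  qed
  then show ?thesis by (metis scaleC_symalg.abs_eq scaleC_single mult.right_neutral)
qed

lemma symalg_induct [case_names monom add, induct type: symalg]:
  assumes "\<And>c m. P (c *\<^sub>C (\<Prod>v\<in>#m. sym_gen v))" "\<And>x y. P x \<Longrightarrow> P y \<Longrightarrow> P (x + y)"
  shows "P x"
proof -
  have "P (abs_symalg p)" for p
  proof (induction p rule: free_induct)
    case zero
    then show ?case using assms(1)[of 0 "{#}"] by (simp add: zero_symalg.abs_eq)
  next
    case (add p q)
    then show ?case using assms(2) by (simp flip: plus_symalg.abs_eq)
  next
    case (single m c)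
    then show ?case using assms(1) by (simp add: symalg_abs_single)
  qed
  then show ?thesis by (metis Quotient3_abs_rep Quotient3_symalg)
qed

lemma free_lift_prod_times:
  fixes f :: "'v \<Rightarrow> 'b::complex_comm_algebra"
  defines "L \<equiv> free_lift (\<lambda>m. \<Prod>v\<in>#m. f v)"
  shows "L (p * q) = L p * L q"
proof -
  have L: "clinear L" unfolding L_def by (rule clinear_free_lift)
  have s: "L (Poly_Mapping.single m c) = c *\<^sub>C (\<Prod>v\<in>#m. f v)" for m c
    by (simp add: L_def)
  have "L (Poly_Mapping.single m c * q) = L (Poly_Mapping.single m c) * L q" for m c
    by (induction q rule: free_induct)
       (simp_all add: clinear_0[OF L] clinear_add[OF L] distrib_left mult_single s
         scaleC_mult_left scaleC_mult_right scaleC_scaleC)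
  then show ?thesis
    by (induction p rule: free_induct)
       (simp_all add: clinear_0[OF L] clinear_add[OF L] distrib_right)
qed

lemma sym_lift_abs:
  assumes "clinear f"
  shows "sym_lift f (abs_symalg p) = free_lift (\<lambda>m. \<Prod>v\<in>#m. f v) p"
proof -
  let ?L = "free_lift (\<lambda>m. \<Prod>v\<in>#m. f v)"
  note L = clinear_free_lift[of "\<lambda>m. \<Prod>v\<in>#m. f v"]
  have "?L z = 0" if "z \<in> module.span (*) sym_relators" for z
    using that
  proof (induction rule: ideal_induct)
    case (step c x y)
    then have "?L x = 0"
      unfolding sym_relators_def
      by (auto simp: clinear_diff[OF L] scaleC_one clinear_add[OF assms]
          clinear_scaleC[OF assms])
    then show ?case using step by (simp add: clinear_add[OF L] free_lift_prod_times)
  qed (simp add: clinear_0[OF L])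
  moreover have "sym_rel (rep_symalg (abs_symalg p)) p"
    by (simp add: Quotient3_symalg rep_abs_rsp_left equivp_reflp[OF equivp_sym_rel])
  ultimately have "?L (rep_symalg (abs_symalg p) - p) = 0"
    by (simp add: sym_rel_def)
  then show ?thesis by (simp add: sym_lift_def clinear_diff[OF L])
qed

lemma symalg_abs_cases: obtains p where "x = abs_symalg p"
  by (metis Quotient3_abs_rep Quotient3_symalg)

lemma
  assumes "clinear f"
  shows sym_lift_gen: "sym_lift f (sym_gen v) = f v"
    and sym_lift_one: "sym_lift f 1 = 1"
    and sym_lift_times: "sym_lift f (x * y) = sym_lift f x * sym_lift f y"
    and clinear_sym_lift: "clinear (sym_lift f)"
proof -
  note abs = sym_lift_abs[OF assms]
  show "sym_lift f (sym_gen v) = f v" by (simp add: sym_gen.abs_eq abs scaleC_one)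
  show "sym_lift f 1 = 1"
    unfolding one_symalg.abs_eq abs single_one[symmetric] free_lift_single by (simp add: scaleC_one)
  obtain p q where pq: "x = abs_symalg p" "y = abs_symalg q" using symalg_abs_cases by metis
  show "sym_lift f (x * y) = sym_lift f x * sym_lift f y"
    unfolding pq times_symalg.abs_eq abs by (rule free_lift_prod_times)
  show "clinear (sym_lift f)"
  proof (rule clinearI)
    fix x y :: "'a symalg" and c
    obtain p q where pq: "x = abs_symalg p" "y = abs_symalg q" using symalg_abs_cases by metis
    show "sym_lift f (x + y) = sym_lift f x + sym_lift f y"
      unfolding pq plus_symalg.abs_eq abs by (rule clinear_add[OF clinear_free_lift])
    show "sym_lift f (c *\<^sub>C x) = c *\<^sub>C sym_lift f x"
      unfolding pq scaleC_symalg.abs_eq abs by (rule clinear_scaleC[OF clinear_free_lift])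
  qed
qed

lemma sym_lift_unique:
  assumes "clinear F" "F 1 = 1" "\<And>x y. F (x * y) = F x * F y" "clinear f" "\<And>v. F (sym_gen v) = f v"
  shows "F = sym_lift f"
proof
  have *: "F (\<Prod>v\<in>#m. sym_gen v) = sym_lift f (\<Prod>v\<in>#m. sym_gen v)" for m
    by (induction m) (simp_all add: assms(2,3,5) sym_lift_gen sym_lift_one sym_lift_times assms(4))
  show "F x = sym_lift f x" for x
    by (induction x)
       (simp_all add: * clinear_add[OF assms(1)] clinear_scaleC[OF assms(1)]
         clinear_add[OF clinear_sym_lift[OF assms(4)]]
         clinear_scaleC[OF clinear_sym_lift[OF assms(4)]])
qed

text \<open>The coproduct \<open>\<Delta>\<close>.\<close>

definition coproduct :: "'v::complex_vector symalg \<Rightarrow> ('v symalg, 'v symalg) tensor" where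
  "coproduct = sym_lift (\<lambda>v. sym_gen v \<otimes>\<^sub>t 1 + 1 \<otimes>\<^sub>t sym_gen v)"

lemma clinear_coproduct_gen: "clinear (\<lambda>v. sym_gen v \<otimes>\<^sub>t 1 + 1 \<otimes>\<^sub>t sym_gen v)"
  by (rule clinearI)
     (simp_all add: clinear_add[OF clinear_sym_gen] clinear_scaleC[OF clinear_sym_gen]
       tensor_add_left tensor_add_right tensor_scaleC_left tensor_scaleC_right scaleC_add_right
       add_ac)

lemmas coproduct_gen = sym_lift_gen[OF clinear_coproduct_gen, folded coproduct_def]
  and coproduct_one = sym_lift_one[OF clinear_coproduct_gen, folded coproduct_def]
  and coproduct_times = sym_lift_times[OF clinear_coproduct_gen, folded coproduct_def]
  and clinear_coproduct = clinear_sym_lift[OF clinear_coproduct_gen, folded coproduct_def]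


section \<open>The algebra of antilinear functionals\<close>

definition sym_dual :: "('v::complex_vector symalg \<Rightarrow> complex) set" where
  "sym_dual = {\<Phi>. antilinear \<Phi>}"

text \<open>\<open>\<Phi> \<otimes> \<Psi>\<close> is antilinear, whereas \<^const>\<open>tensor_lift\<close> produces linear maps; hence the two
  conjugations. See \<open>dual_tensor_pure\<close>.\<close>

definition dual_tensor ::
  "('a::complex_vector \<Rightarrow> complex) \<Rightarrow> ('b::complex_vector \<Rightarrow> complex) \<Rightarrow> ('a, 'b) tensor \<Rightarrow> complex"
where
  "dual_tensor \<Phi> \<Psi> t = cnj (tensor_lift (\<lambda>\<xi> \<eta>. cnj (\<Phi> \<xi> * \<Psi> \<eta>)) t)"

lemma
  assumes "antilinear \<Phi>" "antilinear \<Psi>"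
  shows dual_tensor_pure: "dual_tensor \<Phi> \<Psi> (\<xi> \<otimes>\<^sub>t \<eta>) = \<Phi> \<xi> * \<Psi> \<eta>"
    and antilinear_dual_tensor: "antilinear (dual_tensor \<Phi> \<Psi>)"
proof -
  have B: "cbilinear (\<lambda>\<xi> \<eta>. cnj (\<Phi> \<xi> * \<Psi> \<eta>))"
    by (rule cbilinearI) (use assms in \<open>simp_all add: antilinear_def scaleC_complex_def algebra_simps\<close>)
  show "dual_tensor \<Phi> \<Psi> (\<xi> \<otimes>\<^sub>t \<eta>) = \<Phi> \<xi> * \<Psi> \<eta>"
    by (simp only: dual_tensor_def tensor_lift_pure[OF B] complex_cnj_cnj)
  show "antilinear (dual_tensor \<Phi> \<Psi>)"
    unfolding antilinear_def dual_tensor_def clinear_add[OF clinear_tensor_lift[OF B]]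
      clinear_scaleC[OF clinear_tensor_lift[OF B]] scaleC_complex_def
    by simp
qed

definition dual_times ::
  "('v::complex_vector symalg \<Rightarrow> complex) \<Rightarrow> ('v symalg \<Rightarrow> complex) \<Rightarrow> 'v symalg \<Rightarrow> complex" where
  "dual_times \<Phi> \<Psi> \<theta> = dual_tensor \<Phi> \<Psi> (coproduct \<theta>)"

text \<open>The unit: the conjugate of the augmentation \<open>SV \<rightarrow> \<complex>\<close>, which kills \<open>V\<close>;
  see \<open>dual_times_one_left\<close>.\<close>

definition dual_one :: "'v::complex_vector symalg \<Rightarrow> complex" where
  "dual_one \<theta> = cnj (sym_lift (\<lambda>_. 0) \<theta>)"

primrec dual_power ::
  "('v::complex_vector symalg \<Rightarrow> complex) \<Rightarrow> nat \<Rightarrow> 'v symalg \<Rightarrow> complex" where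
  "dual_power \<Phi> 0 = dual_one"
| "dual_power \<Phi> (Suc n) = dual_times \<Phi> (dual_power \<Phi> n)"

definition dual_exp :: "('v::complex_vector symalg \<Rightarrow> complex) \<Rightarrow> 'v symalg \<Rightarrow> complex" where
  "dual_exp \<Phi> \<theta> = suminf (\<lambda>n. dual_power \<Phi> n \<theta> / fact n)"

lemma dual_times_one_left:
  assumes "\<Phi> \<in> sym_dual"
  shows "dual_times dual_one \<Phi> = \<Phi>"
proof
  fix \<theta>
  have z: "clinear (\<lambda>_::'a. 0 :: complex)" by (rule clinearI) simp_all
  define e :: "'a symalg \<Rightarrow> complex" where "e = sym_lift (\<lambda>_. 0)"
  have e: "clinear e" "e 1 = 1" "e (sym_gen v) = 0" "e (x * y) = e x * e y" for v x y
    unfolding e_def by (rule clinear_sym_lift[OF z] sym_lift_one[OF z] sym_lift_gen[OF z]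
        sym_lift_times[OF z])+
  have \<Phi>: "antilinear \<Phi>" using assms by (simp add: sym_dual_def)
  have one: "antilinear (dual_one :: 'a symalg \<Rightarrow> complex)"
    using clinear_add[OF e(1)] clinear_scaleC[OF e(1)]
    by (simp add: antilinear_def dual_one_def flip: e_def) (simp add: scaleC_complex_def)
  have B: "cbilinear (\<lambda>\<xi> \<eta> :: 'a symalg. e \<xi> *\<^sub>C \<eta>)"
    by (rule cbilinearI)
       (simp_all add: clinear_add[OF e(1)] clinear_scaleC[OF e(1)] scaleC_add_left scaleC_add_right
         scaleC_scaleC scaleC_complex_def mult.commute)
  define T where "T = tensor_lift (\<lambda>\<xi> \<eta> :: 'a symalg. e \<xi> *\<^sub>C \<eta>)"
  have T: "clinear T" unfolding T_def by (rule clinear_tensor_lift[OF B])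
  have T_pure: "T (\<xi> \<otimes>\<^sub>t \<eta>) = e \<xi> *\<^sub>C \<eta>" for \<xi> \<eta>
    unfolding T_def by (rule tensor_lift_pure[OF B])
  have T_times: "T (s * t) = T s * T t" for s t
  proof (induction s)
    case (pure x y)
    show ?case
      by (induction t)
         (simp_all add: T_pure tensor_times_pure e clinear_add[OF T] distrib_left
           scaleC_mult_left scaleC_mult_right scaleC_scaleC)
  qed (simp add: clinear_add[OF T] distrib_right)
  have "(\<lambda>\<theta>. T (coproduct \<theta>)) = sym_lift sym_gen"
  proof (rule sym_lift_unique)
    show "clinear (\<lambda>\<theta>. T (coproduct \<theta>))" by (rule clinear_comp[OF T clinear_coproduct])
  qed (simp_all add: coproduct_one coproduct_times coproduct_gen T_times clinear_sym_gen
      one_tensor_def T_pure e clinear_add[OF T] scaleC_one)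
  moreover have "(\<lambda>\<theta>. \<theta>) = sym_lift (sym_gen :: 'a \<Rightarrow> _)"
    by (rule sym_lift_unique) (auto intro: clinearI clinear_sym_gen)
  ultimately have T_coproduct: "T (coproduct \<theta>) = \<theta>" by metis
  have "dual_tensor dual_one \<Phi> t = \<Phi> (T t)" for t
  proof (induction t)
    case (pure \<xi> \<eta>)
    show ?case
      unfolding dual_tensor_pure[OF one \<Phi>] T_pure
      using \<Phi> by (simp add: antilinear_def dual_one_def e_def)
  next
    case (add s t)
    then show ?case
      using \<Phi> antilinear_dual_tensor[OF one \<Phi>] by (simp add: antilinear_def clinear_add[OF T])
  qed
  then show "dual_times dual_one \<Phi> \<theta> = \<Phi> \<theta>"
    by (simp add: dual_times_def T_coproduct)
qed


section \<open>Creators and annihilators\<close>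

definition creator :: "'v::complex_vector \<Rightarrow> 'v symalg \<Rightarrow> 'v symalg" where
  "creator v \<theta> = sym_gen v * \<theta>"

definition annihilating_derivation ::
  "'v::complex_hilbert \<Rightarrow> ('v symalg \<Rightarrow> 'v symalg) \<Rightarrow> bool" where
  "annihilating_derivation v D \<longleftrightarrow> clinear D \<and> (\<forall>\<theta> \<psi>. D (\<theta> * \<psi>) = D \<theta> * \<psi> + \<theta> * D \<psi>) \<and>
     D 1 = 0 \<and> (\<forall>w. D (sym_gen w) = cinner v w *\<^sub>C 1)"

definition annihilator :: "'v::complex_hilbert \<Rightarrow> 'v symalg \<Rightarrow> 'v symalg" where
  "annihilator v = (THE D. annihilating_derivation v D)"

lemma annihilating_derivation_exists:
  fixes v :: "'v::complex_hilbert"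
  shows "\<exists>D. annihilating_derivation v D"
proof -
  define Q where "Q m = (\<Prod>u\<in>#m. sym_gen u)" for m :: "'v multiset"
  define d where "d m = (\<Sum>w\<in>#m. cinner v w *\<^sub>C Q (m - {#w#}))" for m
  define L where "L = free_lift d"
  have L: "clinear L" unfolding L_def by (rule clinear_free_lift)
  have L_single: "L (Poly_Mapping.single m c) = c *\<^sub>C d m" for m c by (simp add: L_def)
  have Q_add: "Q (m + n) = Q m * Q n" for m n by (simp add: Q_def)
  have sum_scale: "(\<Sum>w\<in>#m. h w) * x = (\<Sum>w\<in>#m. h w * x)" for m and h :: "'v \<Rightarrow> 'v symalg" and x
    by (induction m) (simp_all add: distrib_right)
  have half: "(\<Sum>w\<in>#m. cinner v w *\<^sub>C Q (m + n - {#w#})) = d m * Q n" for m n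
    unfolding d_def sum_scale
    by (intro arg_cong[where f = sum_mset] image_mset_cong)
       (simp add: scaleC_mult_left Q_add[symmetric] multiset_diff_union_assoc add.commute)
  have d_add: "d (m + n) = d m * Q n + Q m * d n" for m n
    using half[of m n] half[of n m] by (simp add: d_def add.commute mult.commute)
  have leibniz: "L (p * q) = L p * abs_symalg q + abs_symalg p * L q" for p q
  proof (induction p rule: free_induct)
    case (single m c)
    show ?case
    proof (induction q rule: free_induct)
      case (single n c')
      show ?case
        by (simp add: mult_single L_single d_add symalg_abs_single Q_def[symmetric]
            scaleC_mult_left scaleC_mult_right scaleC_scaleC scaleC_add_right mult.commute)
    qed (simp_all add: clinear_0[OF L] clinear_add[OF L] distrib_left add_ac
        zero_symalg.abs_eq[symmetric] plus_symalg.abs_eq[symmetric])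
  qed (simp_all add: clinear_0[OF L] clinear_add[OF L] distrib_right add_ac
      zero_symalg.abs_eq[symmetric] plus_symalg.abs_eq[symmetric])
  have "L z = 0 \<and> abs_symalg z = 0" if "z \<in> module.span (*) sym_relators" for z
    using that
  proof (induction rule: ideal_induct)
    case (step c x y)
    have "L x = 0"
      using step(1) unfolding sym_relators_def
      by (auto simp: clinear_diff[OF L] L_single d_def Q_def scaleC_one cinner_add_right
          cinner_scaleC_right scaleC_add_left scaleC_scaleC)
    moreover have "abs_symalg x = 0"
      using ideal_base[OF step(1)] by (simp add: zero_symalg_def symalg.abs_eq_iff sym_rel_def)
    ultimately show ?case
      using step by (simp add: leibniz clinear_add[OF L] flip: plus_symalg.abs_eq times_symalg.abs_eq)
  qed (simp add: clinear_0[OF L] zero_symalg.abs_eq)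
  then have L_cong: "L p = L q" if "sym_rel p q" for p q
    using that clinear_diff[OF L, of p q] by (simp add: sym_rel_def)
  define D where "D x = L (rep_symalg x)" for x
  have D_abs: "D (abs_symalg p) = L p" for p
    unfolding D_def
    by (rule L_cong) (simp add: Quotient3_symalg rep_abs_rsp_left equivp_reflp[OF equivp_sym_rel])
  have "annihilating_derivation v D"
    unfolding annihilating_derivation_def
  proof (intro conjI allI)
    show "clinear D"
    proof (rule clinearI)
      fix x y :: "'v symalg" and c
      obtain p q where pq: "x = abs_symalg p" "y = abs_symalg q" using symalg_abs_cases by metis
      show "D (x + y) = D x + D y"
        unfolding pq plus_symalg.abs_eq D_abs by (rule clinear_add[OF L])
      show "D (c *\<^sub>C x) = c *\<^sub>C D x"
        unfolding pq scaleC_symalg.abs_eq D_abs by (rule clinear_scaleC[OF L])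
    qed
    show "D (x * y) = D x * y + x * D y" for x y
    proof -
      obtain p q where pq: "x = abs_symalg p" "y = abs_symalg q" using symalg_abs_cases by metis
      show ?thesis unfolding pq times_symalg.abs_eq D_abs by (rule leibniz)
    qed
    show "D 1 = 0"
      unfolding one_symalg.abs_eq D_abs single_one[symmetric] L_single by (simp add: d_def)
    show "D (sym_gen w) = cinner v w *\<^sub>C 1" for w
      by (simp add: sym_gen.abs_eq D_abs L_single d_def Q_def scaleC_one)
  qed
  then show ?thesis by (rule exI[where x = D])
qed

lemma annihilating_derivation_unique:
  assumes "annihilating_derivation v D" "annihilating_derivation v D'"
  shows "D = D'"
proof
  have D: "clinear D" "clinear D'" using assms by (auto simp: annihilating_derivation_def)
  have "D (\<Prod>u\<in>#m. sym_gen u) = D' (\<Prod>u\<in>#m. sym_gen u)" for m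
    by (induction m) (use assms in \<open>simp_all add: annihilating_derivation_def\<close>)
  then show "D x = D' x" for x
    by (induction x) (simp_all add: D[THEN clinear_add] D[THEN clinear_scaleC])
qed

lemma annihilator: "annihilating_derivation v (annihilator v)"
  unfolding annihilator_def
  using annihilating_derivation_exists annihilating_derivation_unique
  by (metis the_equality)

definition dual_creator ::
  "'v::complex_hilbert \<Rightarrow> ('v symalg \<Rightarrow> complex) \<Rightarrow> 'v symalg \<Rightarrow> complex" where
  "dual_creator v \<Phi> \<psi> = \<Phi> (annihilator v \<psi>)"

definition dual_annihilator ::
  "'v::complex_vector \<Rightarrow> ('v symalg \<Rightarrow> complex) \<Rightarrow> 'v symalg \<Rightarrow> complex" where
  "dual_annihilator v \<Phi> \<psi> = \<Phi> (creator v \<psi>)"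

text \<open>The operator \<open>\<pi>(v)\<close> on antilinear functionals.\<close>

definition dual_field ::
  "'v::complex_hilbert \<Rightarrow> ('v symalg \<Rightarrow> complex) \<Rightarrow> 'v symalg \<Rightarrow> complex" where
  "dual_field v \<Phi> \<psi> = 1 / of_real (sqrt 2) * (dual_creator v \<Phi> \<psi> + dual_annihilator v \<Phi> \<psi>)"


section \<open>The symplectic group and its Gaussians\<close>

definition cstruct :: "'v::complex_vector \<Rightarrow> 'v" where
  "cstruct v = \<i> *\<^sub>C v"

definition symplectic_form :: "'v::complex_hilbert \<Rightarrow> 'v \<Rightarrow> real" where
  "symplectic_form x y = Im (cinner x y)"

definition Sp :: "('v::complex_hilbert \<Rightarrow> 'v) set" where
  "Sp = {g. linear g \<and> bij g \<and> (\<forall>x y. symplectic_form (g x) (g y) = symplectic_form x y)}"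

definition C_part :: "('v::complex_vector \<Rightarrow> 'v) \<Rightarrow> 'v \<Rightarrow> 'v" where
  "C_part g v = (1 / 2) *\<^sub>C (g v - cstruct (g (cstruct v)))"

definition A_part :: "('v::complex_vector \<Rightarrow> 'v) \<Rightarrow> 'v \<Rightarrow> 'v" where
  "A_part g v = (1 / 2) *\<^sub>C (g v + cstruct (g (cstruct v)))"

definition Z_op :: "('v::complex_vector \<Rightarrow> 'v) \<Rightarrow> 'v \<Rightarrow> 'v" where
  "Z_op g v = - A_part g (inv (C_part g) v)"

text \<open>\<open>\<zeta>\<^sub>g\<close>\<close>

definition gaussian_exponent :: "('v::complex_hilbert \<Rightarrow> 'v) \<Rightarrow> 'v symalg \<Rightarrow> complex" where
  "gaussian_exponent g = (THE \<zeta>. \<zeta> \<in> sym_dual \<and>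
     (\<forall>d \<theta>. d \<noteq> 2 \<longrightarrow> \<theta> \<in> sym_degree d \<longrightarrow> \<zeta> \<theta> = 0) \<and>
     (\<forall>x y. \<zeta> (sym_gen x * sym_gen y) = cinner y (Z_op g x)))"

definition gaussian :: "('v::complex_hilbert \<Rightarrow> 'v) \<Rightarrow> 'v symalg \<Rightarrow> complex" where
  "gaussian g = dual_exp (gaussian_exponent g)"

definition generalized_vacuum ::
  "('v::complex_hilbert \<Rightarrow> 'v) \<Rightarrow> ('v symalg \<Rightarrow> complex) \<Rightarrow> bool" where
  "generalized_vacuum g \<Phi> \<longleftrightarrow> \<Phi> \<in> sym_dual \<and> \<Phi> \<noteq> (\<lambda>_. 0) \<and>
     (\<forall>v \<psi>. dual_field (g v) \<Phi> \<psi> + \<i> * dual_field (g (cstruct v)) \<Phi> \<psi> = 0)"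

end

theory Submission
  imports Defs
begin

text \<open>
  Why the theorem is true. Because \<open>\<Omega>(gx, gy) = \<Omega>(x, y)\<close>, the two parts of \<open>g\<close> satisfy
  \<open>\<parallel>C\<^sub>g x\<parallel>\<^sup>2 = \<parallel>x\<parallel>\<^sup>2 + \<parallel>A\<^sub>g x\<parallel>\<^sup>2\<close>, and \<open>\<langle>C\<^sub>g x | A\<^sub>g y\<rangle>\<close> is symmetric in \<open>x\<close> and \<open>y\<close>. The first identity,
  applied also to \<open>g\<^sup>-\<^sup>1\<close>, whose linear part is adjoint to \<open>C\<^sub>g\<close>, makes \<open>C\<^sub>g\<close> bijective
  (\<open>bij_C_part\<close>); the second makes \<open>Z\<^sub>g = - A\<^sub>g C\<^sub>g\<^sup>-\<^sup>1\<close> symmetric (\<open>Z_op_symmetric\<close>). In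
  \<open>\<pi>(gv) + i \<pi>(gJv)\<close> only the linear part of \<open>g\<close> survives in the annihilator and only the antilinear
  part in the creator; putting \<open>w = C\<^sub>g v\<close>, a vacuum is a nonzero solution \<open>\<Phi>\<close> of the Gaussian equation
  \<open>a(w) \<Phi> = c(Z\<^sub>g w) \<Phi>\<close> for all \<open>w\<close> (\<open>generalized_vacuum_iff\<close>).

  This equation reads \<open>\<Phi>(w \<psi>) = \<Phi>(a(Z\<^sub>g w) \<psi>)\<close>. It expresses \<open>\<Phi>\<close> on degree \<open>d + 1\<close> through
  \<open>\<Phi>\<close> on degree \<open>d - 1\<close>, so a solution is determined by its value at \<open>1\<close>
  (\<open>gaussian_equation_determined\<close>). The Gaussian is a solution with value \<open>1\<close> at \<open>1\<close>: in the algebra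
  \<open>SV'\<close> each \<open>a(w)\<close> is a derivation (\<open>dual_annihilator_times\<close>), while \<open>c(u)\<close> is multiplication by the
  functional \<open>c(u) 1\<close> (\<open>dual_times_creator_right\<close>). Since \<open>a(w) \<zeta>\<^sub>g = c(Z\<^sub>g w) 1\<close>
  (\<open>dual_annihilator_quadratic\<close>), differentiating the exponential series termwise yields
  \<open>a(w) exp \<zeta>\<^sub>g = c(Z\<^sub>g w) exp \<zeta>\<^sub>g\<close> (\<open>dual_annihilator_exp\<close>).

  An antilinear functional is determined by its value at \<open>1\<close> together with all its annihilations
  \<open>a(x) \<Phi> = \<Phi>(x \<cdot> _)\<close>. The identities in \<open>SV'\<close> are therefore proved by induction over monomials:
  both sides are compared at \<open>1\<close> and then after applying \<open>a(x)\<close>, with the functionals themselves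
  arbitrary in the induction.
\<close>

section \<open>Antilinear functionals, creators and annihilators\<close>

abbreviation sym_monom :: "'v::complex_vector multiset \<Rightarrow> 'v symalg" where
  "sym_monom m \<equiv> \<Prod>v\<in>#m. sym_gen v"

lemma antilinear_add: "antilinear f \<Longrightarrow> f (x + y) = f x + f y"
  and antilinear_scaleC: "antilinear f \<Longrightarrow> f (c *\<^sub>C x) = cnj c * f x"
  by (simp_all add: antilinear_def)

lemma antilinear_0: "antilinear f \<Longrightarrow> f 0 = 0"
  using antilinear_scaleC[of f 0 0] by simp

lemma antilinear_monom_ext:
  assumes "antilinear F" "antilinear G" "\<And>m. F (sym_monom m) = G (sym_monom m)"
  shows "F = G"
proof
  show "F \<theta> = G \<theta>" for \<theta>
    by (induction \<theta>) (simp_all add: assms antilinear_add antilinear_scaleC)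
qed

lemma
  shows clinear_annihilator: "clinear (annihilator v)"
    and annihilator_one: "annihilator v 1 = 0"
    and annihilator_gen: "annihilator v (sym_gen w) = cinner v w *\<^sub>C 1"
    and annihilator_times:
      "annihilator v (\<theta> * \<psi>) = annihilator v \<theta> * \<psi> + \<theta> * annihilator v \<psi>"
  using annihilator[of v] by (auto simp: annihilating_derivation_def)

lemma annihilator_gen_times:
  "annihilator v (sym_gen w * \<theta>) = cinner v w *\<^sub>C \<theta> + sym_gen w * annihilator v \<theta>"
  by (simp add: annihilator_times annihilator_gen scaleC_mult_left)

lemma antilinear_dual_annihilator: "antilinear \<Phi> \<Longrightarrow> antilinear (dual_annihilator v \<Phi>)"
  by (simp add: antilinear_def dual_annihilator_def creator_def distrib_left scaleC_mult_right)

lemma antilinear_dual_creator: "antilinear \<Phi> \<Longrightarrow> antilinear (dual_creator v \<Phi>)"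
  by (simp add: antilinear_def dual_creator_def clinear_add[OF clinear_annihilator]
      clinear_scaleC[OF clinear_annihilator])

text \<open>The canonical commutation relation \<open>[a(x), c(u)] = \<langle>x|u\<rangle>\<close> on \<open>SV'\<close>.\<close>

lemma dual_annihilator_creator:
  assumes "antilinear \<Phi>"
  shows "dual_annihilator x (dual_creator u \<Phi>)
    = (\<lambda>\<theta>. cinner x u * \<Phi> \<theta> + dual_creator u (dual_annihilator x \<Phi>) \<theta>)"
  by (simp add: dual_annihilator_def dual_creator_def creator_def annihilator_gen_times
      antilinear_add[OF assms] antilinear_scaleC[OF assms] fun_eq_iff cinner_commute[of x u])

lemma antilinear_combination:
  "antilinear \<Phi> \<Longrightarrow> antilinear \<Psi> \<Longrightarrow> antilinear (\<lambda>\<theta>. c * \<Phi> \<theta> + \<Psi> \<theta>)"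
  by (simp add: antilinear_def algebra_simps)

lemma antilinear_scale: "antilinear \<Phi> \<Longrightarrow> antilinear (\<lambda>\<theta>. c * \<Phi> \<theta>)"
  by (simp add: antilinear_def algebra_simps)

lemma
  fixes \<theta> \<psi> :: "'v::complex_vector symalg"
  shows dual_one_one: "dual_one (1 :: 'v symalg) = 1"
    and dual_one_times: "dual_one (\<theta> * \<psi>) = dual_one \<theta> * dual_one \<psi>"
    and dual_one_gen: "dual_one (sym_gen (v :: 'v)) = 0"
    and antilinear_dual_one: "antilinear (dual_one :: 'v symalg \<Rightarrow> complex)"
proof -
  have z: "clinear (\<lambda>_::'v. 0 :: complex)" by (rule clinearI) simp_all
  show "dual_one (1 :: 'v symalg) = 1" "dual_one (\<theta> * \<psi>) = dual_one \<theta> * dual_one \<psi>"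
      "dual_one (sym_gen v) = 0"
    by (simp_all add: dual_one_def sym_lift_one[OF z] sym_lift_times[OF z] sym_lift_gen[OF z])
  show "antilinear (dual_one :: 'v symalg \<Rightarrow> complex)"
    by (simp add: antilinear_def dual_one_def clinear_add[OF clinear_sym_lift[OF z]]
        clinear_scaleC[OF clinear_sym_lift[OF z]] scaleC_complex_def)
qed

section \<open>The product of antilinear functionals\<close>

lemma antilinear_dual_times:
  assumes "antilinear \<Phi>" "antilinear \<Psi>"
  shows "antilinear (dual_times \<Phi> \<Psi>)"
  using antilinear_dual_tensor[OF assms]
  by (simp add: antilinear_def dual_times_def clinear_add[OF clinear_coproduct]
      clinear_scaleC[OF clinear_coproduct])

lemma dual_times_at_one:
  assumes "antilinear \<Phi>" "antilinear \<Psi>"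
  shows "dual_times \<Phi> \<Psi> 1 = \<Phi> 1 * \<Psi> 1"
  by (simp add: dual_times_def coproduct_one one_tensor_def dual_tensor_pure assms)

text \<open>Since \<open>\<Delta>(x \<theta>) = (x \<otimes> 1 + 1 \<otimes> x) \<Delta>\<theta>\<close>, multiplying the argument by \<open>x\<close> acts on either factor.
  Together with the value at \<open>1\<close> this recursion determines the product, and it replaces the coproduct
  in all that follows.\<close>

lemma dual_times_gen_times:
  assumes "antilinear \<Phi>" "antilinear \<Psi>"
  shows "dual_times \<Phi> \<Psi> (sym_gen x * \<theta>)
    = dual_times (dual_annihilator x \<Phi>) \<Psi> \<theta> + dual_times \<Phi> (dual_annihilator x \<Psi>) \<theta>"
proof -
  note A = antilinear_dual_annihilator[OF assms(1), of x] antilinear_dual_annihilator[OF assms(2), of x]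
  note dual = dual_tensor_pure[OF assms] dual_tensor_pure[OF A(1) assms(2)]
    dual_tensor_pure[OF assms(1) A(2)]
  note duals_add = antilinear_add[OF antilinear_dual_tensor[OF assms]]
    antilinear_add[OF antilinear_dual_tensor[OF A(1) assms(2)]]
    antilinear_add[OF antilinear_dual_tensor[OF assms(1) A(2)]]
  have "dual_tensor \<Phi> \<Psi> ((sym_gen x \<otimes>\<^sub>t 1 + 1 \<otimes>\<^sub>t sym_gen x) * t)
      = dual_tensor (dual_annihilator x \<Phi>) \<Psi> t + dual_tensor \<Phi> (dual_annihilator x \<Psi>) t" for t
  proof (induction t)
    case (pure \<xi> \<eta>)
    show ?case
      by (simp add: distrib_right tensor_times_pure duals_add dual)
         (simp add: dual_annihilator_def creator_def)
  next
    case (add s t)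
    then show ?case by (simp add: distrib_left duals_add)
  qed
  then show ?thesis by (simp add: dual_times_def coproduct_times coproduct_gen)
qed

lemma dual_annihilator_times:
  assumes "antilinear \<Phi>" "antilinear \<Psi>"
  shows "dual_annihilator x (dual_times \<Phi> \<Psi>)
    = (\<lambda>\<theta>. dual_times (dual_annihilator x \<Phi>) \<Psi> \<theta> + dual_times \<Phi> (dual_annihilator x \<Psi>) \<theta>)"
  by (rule ext) (simp add: dual_annihilator_def[of x "dual_times \<Phi> \<Psi>"] creator_def dual_times_gen_times[OF assms])

lemma dual_times_commute:
  assumes "antilinear \<Phi>" "antilinear \<Psi>"
  shows "dual_times \<Phi> \<Psi> = dual_times \<Psi> \<Phi>"
proof (rule antilinear_monom_ext)
  show "dual_times \<Phi> \<Psi> (sym_monom m) = dual_times \<Psi> \<Phi> (sym_monom m)" for m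
    using assms
  proof (induction m arbitrary: \<Phi> \<Psi>)
    case (add x m)
    then show ?case by (simp add: dual_times_gen_times antilinear_dual_annihilator)
  qed (simp add: dual_times_at_one)
qed (intro antilinear_dual_times assms)+

lemma dual_times_combination_right:
  assumes "antilinear \<Phi>" "antilinear \<Psi>" "antilinear \<Psi>'"
  shows "dual_times \<Phi> (\<lambda>\<theta>. c * \<Psi> \<theta> + \<Psi>' \<theta>) = (\<lambda>\<theta>. c * dual_times \<Phi> \<Psi> \<theta> + dual_times \<Phi> \<Psi>' \<theta>)"
proof (rule antilinear_monom_ext)
  have "dual_times \<Phi> (\<lambda>\<theta>. c * \<Psi> \<theta> + \<Psi>' \<theta>) (sym_monom m)
      = c * dual_times \<Phi> \<Psi> (sym_monom m) + dual_times \<Phi> \<Psi>' (sym_monom m)" for m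
    using assms
  proof (induction m arbitrary: \<Phi> \<Psi> \<Psi>')
    case (add x m)
    have "dual_annihilator x (\<lambda>\<theta>. c * \<Psi> \<theta> + \<Psi>' \<theta>)
        = (\<lambda>\<theta>. c * dual_annihilator x \<Psi> \<theta> + dual_annihilator x \<Psi>' \<theta>)"
      by (simp add: dual_annihilator_def fun_eq_iff)
    with add show ?case
      by (simp add: dual_times_gen_times antilinear_dual_annihilator antilinear_combination
          distrib_left)
  qed (simp add: dual_times_at_one antilinear_combination distrib_left)
  then show "dual_times \<Phi> (\<lambda>\<theta>. c * \<Psi> \<theta> + \<Psi>' \<theta>) (sym_monom m)
      = c * dual_times \<Phi> \<Psi> (sym_monom m) + dual_times \<Phi> \<Psi>' (sym_monom m)" for m .
qed (intro antilinear_dual_times antilinear_combination assms)+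

lemma dual_times_scale_right:
  assumes "antilinear \<Phi>" "antilinear \<Psi>"
  shows "dual_times \<Phi> (\<lambda>\<theta>. c * \<Psi> \<theta>) = (\<lambda>\<theta>. c * dual_times \<Phi> \<Psi> \<theta>)"
  using dual_times_combination_right[OF assms assms(2), of "c - 1"]
  by (simp add: algebra_simps)

text \<open>This says that \<open>c(u)\<close> is multiplication by an element of \<open>SV'\<close>. The term \<open>\<langle>x|u\<rangle> \<Phi>\<Psi>\<close> produced by
  the commutation relation appears on both sides of the induction step.\<close>

lemma dual_times_creator_right:
  assumes "antilinear \<Phi>" "antilinear \<Psi>"
  shows "dual_times \<Phi> (dual_creator u \<Psi>) = dual_creator u (dual_times \<Phi> \<Psi>)"
proof (rule antilinear_monom_ext)
  show "dual_times \<Phi> (dual_creator u \<Psi>) (sym_monom m) = dual_creator u (dual_times \<Phi> \<Psi>) (sym_monom m)" for m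
    using assms
  proof (induction m arbitrary: \<Phi> \<Psi>)
    case empty
    then have "antilinear (dual_times \<Phi> \<Psi>)" by (intro antilinear_dual_times)
    with empty show ?case
      by (simp add: dual_times_at_one antilinear_dual_creator)
         (simp add: dual_creator_def annihilator_one antilinear_0)
  next
    case (add x m)
    note al = add.prems antilinear_dual_annihilator[OF add.prems(1), of x]
      antilinear_dual_annihilator[OF add.prems(2), of x] antilinear_dual_creator[OF add.prems(2), of u]
    note al2 = antilinear_dual_creator[OF al(4), of u]
    let ?M = "sym_monom m"
    have "dual_times \<Phi> (dual_creator u \<Psi>) (sym_gen x * ?M)
        = dual_times (dual_annihilator x \<Phi>) (dual_creator u \<Psi>) ?M
          + (cinner x u * dual_times \<Phi> \<Psi> ?M
          + dual_times \<Phi> (dual_creator u (dual_annihilator x \<Psi>)) ?M)"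
      by (simp add: dual_times_gen_times al dual_annihilator_creator
          dual_times_combination_right[OF al(1,2) al2])
    also have "\<dots> = dual_creator u (dual_times (dual_annihilator x \<Phi>) \<Psi>) ?M
          + (cinner x u * dual_times \<Phi> \<Psi> ?M
          + dual_creator u (dual_times \<Phi> (dual_annihilator x \<Psi>)) ?M)"
      by (simp add: add.IH al)
    also have "\<dots> = dual_annihilator x (dual_creator u (dual_times \<Phi> \<Psi>)) ?M"
      by (simp add: dual_annihilator_creator antilinear_dual_times al)
         (simp add: dual_creator_def dual_annihilator_times al)
    finally show ?case by (simp add: dual_annihilator_def creator_def)
  qed
qed (intro antilinear_dual_times antilinear_dual_creator assms)+

lemma dual_times_creator_left:
  assumes "antilinear \<Phi>" "antilinear \<Psi>"
  shows "dual_times (dual_creator u \<Phi>) \<Psi> = dual_creator u (dual_times \<Phi> \<Psi>)"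
  by (simp add: dual_times_commute[of _ \<Psi>] assms antilinear_dual_creator dual_times_creator_right)

section \<open>Quadratic functionals\<close>

text \<open>A function on multisets that is linear in each entry is symmetric and multilinear, so it vanishes
  on the ideal defining \<open>SV\<close> and descends to \<open>SV\<close>. This constructs functionals degree by degree, whereas
  \<^const>\<open>sym_lift\<close> produces only algebra homomorphisms.\<close>

lemma symmetric_multilinear_extension:
  fixes h :: "'v::complex_vector multiset \<Rightarrow> 'b::complex_vector"
  assumes add: "\<And>v w m. h (add_mset (v + w) m) = h (add_mset v m) + h (add_mset w m)"
    and scale: "\<And>c v m. h (add_mset (c *\<^sub>C v) m) = c *\<^sub>C h (add_mset v m)"
  obtains H where "clinear H" "\<And>m. H (sym_monom m) = h m"
proof -
  define L where "L = free_lift h"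
  have L: "clinear L" unfolding L_def by (rule clinear_free_lift)
  have L_single: "L (Poly_Mapping.single m c) = c *\<^sub>C h m" for m c by (simp add: L_def)
  have mult: "L (p * r) = 0" if "r \<in> sym_relators" for p r
  proof (induction p rule: free_induct)
    case (single m c)
    show ?case
      using that unfolding sym_relators_def
      by (auto simp: right_diff_distrib mult_single clinear_diff[OF L] L_single add scale
          scaleC_add_right scaleC_scaleC)
  qed (simp_all add: clinear_0[OF L] clinear_add[OF L] distrib_right)
  have "L z = 0" if "z \<in> module.span (*) sym_relators" for z
    using that by (induction rule: ideal_induct) (simp_all add: clinear_0[OF L] clinear_add[OF L] mult)
  then have cong: "L p = L q" if "sym_rel p q" for p q
    using that clinear_diff[OF L, of p q] by (simp add: sym_rel_def)
  define H where "H x = L (rep_symalg x)" for x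
  have H_abs: "H (abs_symalg p) = L p" for p
    unfolding H_def
    by (rule cong) (simp add: Quotient3_symalg rep_abs_rsp_left equivp_reflp[OF equivp_sym_rel])
  show ?thesis
  proof
    show "clinear H"
    proof (rule clinearI)
      fix x y :: "'v symalg" and c
      obtain p q where pq: "x = abs_symalg p" "y = abs_symalg q" using symalg_abs_cases by metis
      show "H (x + y) = H x + H y"
        unfolding pq plus_symalg.abs_eq H_abs by (rule clinear_add[OF L])
      show "H (c *\<^sub>C x) = c *\<^sub>C H x"
        unfolding pq scaleC_symalg.abs_eq H_abs by (rule clinear_scaleC[OF L])
    qed
    show "H (sym_monom m) = h m" for m
      using H_abs[of "Poly_Mapping.single m 1"]
      by (simp add: symalg_abs_single L_single scaleC_one)
  qed
qed

lemma sym_monom_in_degree: "sym_monom m \<in> sym_degree (size m)"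
  unfolding sym_degree_def by (rule cvec.span_base) blast

lemma antilinear_vanishes_on_degree:
  assumes "antilinear \<Phi>" "\<And>m. size m = d \<Longrightarrow> \<Phi> (sym_monom m) = 0" "\<theta> \<in> sym_degree d"
  shows "\<Phi> \<theta> = 0"
  using assms(3) unfolding sym_degree_def
  by (induction rule: cvec.span_induct_alt)
     (auto simp: antilinear_0 antilinear_add antilinear_scaleC assms(1,2))

text \<open>The characterization of \<open>\<zeta>\<^sub>g\<close>, for an arbitrary form in place of \<open>\<langle>y|Z\<^sub>g x\<rangle>\<close>.\<close>

definition quadratic_functional ::
  "('v::complex_vector \<Rightarrow> 'v \<Rightarrow> complex) \<Rightarrow> ('v symalg \<Rightarrow> complex) \<Rightarrow> bool" where
  "quadratic_functional b \<zeta> \<longleftrightarrow> \<zeta> \<in> sym_dual \<and>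
     (\<forall>d \<theta>. d \<noteq> 2 \<longrightarrow> \<theta> \<in> sym_degree d \<longrightarrow> \<zeta> \<theta> = 0) \<and>
     (\<forall>x y. \<zeta> (sym_gen x * sym_gen y) = b x y)"

lemma quadratic_functional_exists:
  fixes b :: "'v::complex_vector \<Rightarrow> 'v \<Rightarrow> complex"
  assumes sym: "\<And>x y. b x y = b y x" and b: "\<And>x. antilinear (b x)"
  obtains \<zeta> where "quadratic_functional b \<zeta>"
proof -
  note add1 = antilinear_add[OF b] and scale1 = antilinear_scaleC[OF b]
  have add2: "b (x + x') y = b x y + b x' y" and scale2: "b (c *\<^sub>C x) y = cnj c * b x y"
    for x x' y c
    by (metis sym add1, metis sym scale1)
  \<comment> \<open>A formula that refers to no order of the two entries: by polarization, \<open>b(x + y, x + y)\<close> minus the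
    diagonal terms is \<open>2 b(x, y)\<close>. The conjugation makes \<open>h\<close> linear.\<close>
  define h where "h m = (if size m = 2 then
      cnj ((b (\<Sum>\<^sub># m) (\<Sum>\<^sub># m) - (\<Sum>v\<in>#m. b v v)) / 2) else 0)" for m
  have h_pair: "h {#x, y#} = cnj (b x y)" for x y
    by (simp add: h_def add1 add2 sym[of y x])
  have h_add: "h (add_mset v m) = (if size m = 1 then cnj (b v (\<Sum>\<^sub># m)) else 0)" for v m
  proof (cases "size m = 1")
    case True
    then obtain y where "m = {#y#}" using size_1_singleton_mset by blast
    then show ?thesis by (simp add: h_pair)
  qed (simp add: h_def)
  obtain H where H: "clinear H" "\<And>m. H (sym_monom m) = h m"
    by (rule symmetric_multilinear_extension[of h])
       (simp_all add: h_add add2 scale2 scaleC_complex_def)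
  define \<zeta> where "\<zeta> \<theta> = cnj (H \<theta>)" for \<theta>
  have \<zeta>: "antilinear \<zeta>"
    by (simp add: antilinear_def \<zeta>_def clinear_add[OF H(1)] clinear_scaleC[OF H(1)] scaleC_complex_def)
  have "\<zeta> \<theta> = 0" if "d \<noteq> 2" "\<theta> \<in> sym_degree d" for d \<theta>
    by (rule antilinear_vanishes_on_degree[OF \<zeta> _ that(2)]) (use that(1) in \<open>simp add: \<zeta>_def H h_def\<close>)
  moreover have "\<zeta> (sym_gen x * sym_gen y) = b x y" for x y
    using H(2)[of "{#x, y#}"] by (simp add: \<zeta>_def h_pair)
  ultimately have "quadratic_functional b \<zeta>"
    using \<zeta> by (simp add: quadratic_functional_def sym_dual_def)
  then show ?thesis by (rule that)
qed

lemma quadratic_functional_unique: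
  assumes "quadratic_functional b \<zeta>" "quadratic_functional b \<zeta>'"
  shows "\<zeta> = \<zeta>'"
proof (rule antilinear_monom_ext)
  show "antilinear \<zeta>" "antilinear \<zeta>'"
    using assms by (simp_all add: quadratic_functional_def sym_dual_def)
  show "\<zeta> (sym_monom m) = \<zeta>' (sym_monom m)" for m
  proof (cases "size m = 2")
    case True
    then obtain x m' where m': "m = add_mset x m'" "size m' = 1"
      using size_eq_Suc_imp_eq_union[of m 1] by auto
    then obtain y where "m = {#x, y#}" using size_1_singleton_mset by blast
    then show ?thesis using assms by (simp add: quadratic_functional_def)
  next
    case False
    then show ?thesis
      using assms sym_monom_in_degree[of m] by (metis quadratic_functional_def)
  qed
qed

lemma quadratic_functionalD:
  assumes "quadratic_functional b \<zeta>"
  shows "antilinear \<zeta>" "size m \<noteq> 2 \<Longrightarrow> \<zeta> (sym_monom m) = 0" "\<zeta> (sym_gen x * sym_gen y) = b x y"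
  using assms sym_monom_in_degree[of m] by (auto simp: quadratic_functional_def sym_dual_def)

text \<open>The differential of a quadratic form is linear: both sides vanish outside degree one, where
  they send \<open>x\<close> to \<open>\<langle>x|Z w\<rangle>\<close>.\<close>

lemma dual_annihilator_quadratic:
  assumes "quadratic_functional (\<lambda>x y. cinner y (Z x)) \<zeta>"
  shows "dual_annihilator w \<zeta> = dual_creator (Z w) dual_one"
proof (rule antilinear_monom_ext)
  note \<zeta> = quadratic_functionalD[OF assms]
  show "antilinear (dual_annihilator w \<zeta>)" "antilinear (dual_creator (Z w) dual_one)"
    by (simp_all add: antilinear_dual_annihilator antilinear_dual_creator antilinear_dual_one \<zeta>(1))
  have shift: "dual_annihilator w \<zeta> (sym_monom m) = \<zeta> (sym_monom (add_mset w m))" for m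
    by (simp add: dual_annihilator_def creator_def)
  show "dual_annihilator w \<zeta> (sym_monom m) = dual_creator (Z w) dual_one (sym_monom m)" for m
  proof (cases m)
    case empty
    then show ?thesis
      unfolding shift using \<zeta>(2)[of "{#w#}"]
      by (simp add: dual_creator_def annihilator_one antilinear_0[OF antilinear_dual_one])
  next
    case m: (add x m')
    show ?thesis
    proof (cases m')
      case empty
      then show ?thesis
        unfolding shift m using \<zeta>(3)[of w x]
        by (simp add: dual_creator_def annihilator_gen antilinear_scaleC[OF antilinear_dual_one]
            dual_one_one flip: cinner_commute)
    next
      case (add y r)
      then show ?thesis
        unfolding shift m using \<zeta>(2)[of "add_mset w (add_mset x m')"]
        by (simp add: dual_creator_def annihilator_gen_times distrib_left scaleC_mult_right
            antilinear_add[OF antilinear_dual_one] antilinear_scaleC[OF antilinear_dual_one]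
            dual_one_times dual_one_gen)
    qed
  qed
qed

section \<open>Exponentials\<close>

lemma antilinear_dual_power: "antilinear \<zeta> \<Longrightarrow> antilinear (dual_power \<zeta> n)"
  by (induction n) (simp_all add: antilinear_dual_one antilinear_dual_times)

text \<open>The power rule \<open>a(w) \<zeta>\<^sup>n = n (a(w) \<zeta>) \<zeta>\<^sup>n\<^sup>-\<^sup>1\<close> for a derivation. For \<open>n = 0\<close> the truncated exponent
  is harmless because of the factor \<open>n\<close>.\<close>

lemma dual_annihilator_power:
  assumes "antilinear \<zeta>" "dual_annihilator w \<zeta> = dual_creator u dual_one"
  shows "dual_annihilator w (dual_power \<zeta> n)
    = (\<lambda>\<theta>. of_nat n * dual_creator u (dual_power \<zeta> (n - 1)) \<theta>)"
proof (induction n)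
  case 0
  show ?case by (simp add: dual_annihilator_def creator_def dual_one_times dual_one_gen)
next
  case (Suc n)
  note al = assms(1) antilinear_dual_power[OF assms(1)] antilinear_dual_one
  have 1: "dual_times (dual_annihilator w \<zeta>) (dual_power \<zeta> n) = dual_creator u (dual_power \<zeta> n)"
    using al(2)[of n]
    by (simp add: assms(2) dual_times_creator_left al dual_times_one_left sym_dual_def)
  have "dual_times \<zeta> (dual_annihilator w (dual_power \<zeta> n))
      = (\<lambda>\<theta>. of_nat n * dual_creator u (dual_times \<zeta> (dual_power \<zeta> (n - 1))) \<theta>)"
    by (simp add: Suc.IH dual_times_scale_right antilinear_dual_creator al dual_times_creator_right)
  also have "\<dots> = (\<lambda>\<theta>. of_nat n * dual_creator u (dual_power \<zeta> n) \<theta>)"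
    by (cases n) simp_all
  finally show ?case
    by (simp add: dual_annihilator_times al 1 algebra_simps)
qed

lemma gen_times_degree:
  assumes "\<theta> \<in> sym_degree d"
  shows "sym_gen x * \<theta> \<in> sym_degree (Suc d)"
  using assms unfolding sym_degree_def[of d]
proof (induction rule: cvec.span_induct_alt)
  case base
  then show ?case by (simp add: sym_degree_def cvec.span_zero)
next
  case (step c \<psi> \<theta>)
  then obtain m where m: "\<psi> = sym_monom m" "size m = d" by blast
  have "sym_gen x * \<psi> \<in> sym_degree (Suc d)"
    using sym_monom_in_degree[of "add_mset x m"] m by simp
  with step show ?case
    by (simp add: distrib_left scaleC_mult_right sym_degree_def cvec.span_add cvec.span_scale)
qed

lemma annihilator_degree: "annihilator v (sym_monom (add_mset x m)) \<in> sym_degree (size m)"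
proof (induction m arbitrary: x)
  case empty
  then show ?case
    using sym_monom_in_degree[of "{#} :: 'a multiset"]
    by (simp add: annihilator_gen sym_degree_def cvec.span_scale)
next
  case (add y m)
  have "cinner v x *\<^sub>C sym_monom (add_mset y m) \<in> sym_degree (size (add_mset y m))"
    using sym_monom_in_degree[of "add_mset y m"] by (simp only: sym_degree_def cvec.span_scale)
  moreover have "sym_gen x * annihilator v (sym_monom (add_mset y m)) \<in> sym_degree (size (add_mset y m))"
    using gen_times_degree[OF add] by simp
  ultimately have "cinner v x *\<^sub>C sym_monom (add_mset y m)
      + sym_gen x * annihilator v (sym_monom (add_mset y m)) \<in> sym_degree (size (add_mset y m))"
    unfolding sym_degree_def by (rule cvec.span_add)
  then show ?case by (simp only: image_mset_add_mset prod_mset.add_mset annihilator_gen_times)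
qed

text \<open>This makes the exponential series a finite sum at each element of \<open>SV\<close>. Splitting off one factor of
  the monomial lowers the exponent by one and the degree by two, down to \<open>\<zeta>\<^sup>n(1) = \<zeta>(1)\<^sup>n = 0\<close>.\<close>

lemma dual_power_vanishes:
  assumes \<zeta>: "antilinear \<zeta>" "\<zeta> 1 = 0" "\<And>w. dual_annihilator w \<zeta> = dual_creator (Z w) dual_one"
    and "size m < n"
  shows "dual_power \<zeta> n (sym_monom m) = 0"
  using assms(4)
proof (induction "size m" arbitrary: m n rule: less_induct)
  case less
  note al = antilinear_dual_power[OF \<zeta>(1)]
  show ?case
  proof (cases m)
    case empty
    with less.prems show ?thesis
      by (cases n) (simp_all add: dual_times_at_one \<zeta>(1,2) al)
  next
    case m: (add x m')
    have "dual_power \<zeta> n (sym_monom m) = dual_annihilator x (dual_power \<zeta> n) (sym_monom m')"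
      by (simp add: m dual_annihilator_def creator_def)
    also have "\<dots> = of_nat n * dual_power \<zeta> (n - 1) (annihilator (Z x) (sym_monom m'))"
      by (simp add: dual_annihilator_power[OF \<zeta>(1,3)] dual_creator_def)
    also have "dual_power \<zeta> (n - 1) (annihilator (Z x) (sym_monom m')) = 0"
    proof (cases m')
      case empty
      then show ?thesis by (simp add: annihilator_one antilinear_0[OF al])
    next
      case (add y r)
      show ?thesis
        by (rule antilinear_vanishes_on_degree[OF al _ annihilator_degree[of "Z x" y r, folded add]])
           (use less m add in auto)
    qed
    finally show ?thesis by simp
  qed
qed

lemma
  assumes \<zeta>: "antilinear \<zeta>" "\<zeta> 1 = 0" "\<And>w. dual_annihilator w \<zeta> = dual_creator (Z w) dual_one"
  shows antilinear_dual_exp: "antilinear (dual_exp \<zeta>)"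
    and dual_exp_at_one: "dual_exp \<zeta> 1 = 1"
    and dual_annihilator_exp: "dual_annihilator w (dual_exp \<zeta>) = dual_creator (Z w) (dual_exp \<zeta>)"
proof -
  note al = antilinear_dual_power[OF \<zeta>(1)]
  have stop: "\<exists>N. \<forall>n\<ge>N. dual_power \<zeta> n \<theta> = 0" for \<theta>
  proof (induction \<theta>)
    case (monom c m)
    show ?case
      by (rule exI[where x = "Suc (size m)"])
         (auto simp: antilinear_scaleC[OF al] dual_power_vanishes[OF \<zeta>])
  next
    case (add \<theta> \<psi>)
    then obtain M N where "\<forall>n\<ge>M. dual_power \<zeta> n \<theta> = 0" "\<forall>n\<ge>N. dual_power \<zeta> n \<psi> = 0" by blast
    then show ?case
      by (intro exI[where x = "max M N"]) (simp add: antilinear_add[OF al])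
  qed
  have sm: "summable (\<lambda>n. dual_power \<zeta> n \<theta> / fact n)" for \<theta>
  proof -
    obtain N where "\<forall>n\<ge>N. dual_power \<zeta> n \<theta> = 0" using stop by blast
    then show ?thesis by (intro summable_finite[of "{..<N}"]) auto
  qed
  show "antilinear (dual_exp \<zeta>)"
    unfolding antilinear_def dual_exp_def
    by (simp add: antilinear_add[OF al] antilinear_scaleC[OF al] add_divide_distrib suminf_add sm
        suminf_mult flip: times_divide_eq_right)
  have "dual_power \<zeta> n 1 = (if n = 0 then 1 else 0)" for n
    by (cases n) (simp_all add: dual_one_one dual_times_at_one \<zeta>(1,2) al)
  then have "(\<lambda>n. dual_power \<zeta> n 1 / fact n) = (\<lambda>n. if n = 0 then 1 else 0)" by auto
  then show "dual_exp \<zeta> 1 = 1"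
    using suminf_finite[of "{0 :: nat}" "\<lambda>n. if n = 0 then 1 else 0 :: complex"]
    by (simp add: dual_exp_def)
  show "dual_annihilator w (dual_exp \<zeta>) = dual_creator (Z w) (dual_exp \<zeta>)"
  proof
    fix \<theta>
    let ?f = "\<lambda>n. dual_power \<zeta> n (creator w \<theta>) / fact n"
    have "?f (Suc n) = dual_power \<zeta> n (annihilator (Z w) \<theta>) / fact n" for n
      using fun_cong[OF dual_annihilator_power[OF \<zeta>(1,3), of w "Suc n"], of \<theta>]
      by (simp add: dual_annihilator_def dual_creator_def del: of_nat_Suc dual_power.simps)
    moreover have "?f 0 = 0"
      using fun_cong[OF dual_annihilator_power[OF \<zeta>(1,3), of w 0], of \<theta>]
      by (simp add: dual_annihilator_def)
    ultimately show "dual_annihilator w (dual_exp \<zeta>) \<theta> = dual_creator (Z w) (dual_exp \<zeta>) \<theta>"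
      using suminf_split_head[OF sm[of "creator w \<theta>"]]
      by (simp add: dual_exp_def dual_annihilator_def dual_creator_def)
  qed
qed

text \<open>The equation rewrites \<open>\<Phi>(x \<theta>)\<close> as \<open>\<Phi>(a(Z x) \<theta>)\<close>, which lowers the degree by two; in the end only
  multiples of \<open>\<Phi>(1)\<close> remain. Hence two solutions with the same value at \<open>1\<close> are equal.\<close>

lemma gaussian_equation_determined:
  assumes \<Phi>: "antilinear \<Phi>" "\<And>w. dual_annihilator w \<Phi> = dual_creator (Z w) \<Phi>" "\<Phi> 1 = 0"
  shows "\<Phi> = (\<lambda>_. 0)"
proof (rule antilinear_monom_ext)
  show "\<Phi> (sym_monom m) = 0" for m
  proof (induction "size m" arbitrary: m rule: less_induct)
    case less
    show ?case
    proof (cases m)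
      case empty
      then show ?thesis by (simp add: \<Phi>(3))
    next
      case m: (add x m')
      have "\<Phi> (sym_monom m) = \<Phi> (annihilator (Z x) (sym_monom m'))"
        using fun_cong[OF \<Phi>(2), of x "sym_monom m'"]
        by (simp add: m dual_annihilator_def creator_def dual_creator_def)
      also have "\<dots> = 0"
      proof (cases m')
        case empty
        then show ?thesis by (simp add: annihilator_one antilinear_0[OF \<Phi>(1)])
      next
        case (add y r)
        show ?thesis
          by (rule antilinear_vanishes_on_degree[OF \<Phi>(1) _ annihilator_degree[of "Z x" y r, folded add]])
             (use less m add in auto)
      qed
      finally show ?thesis .
    qed
  qed
  show "antilinear \<Phi>" by (rule \<Phi>(1))
qed (simp add: antilinear_def)

section \<open>Surjectivity of operators that are bounded below\<close>

lemma cinner_add_left: "cinner (x + y) z = cinner x z + cinner y z"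
  by (metis cinner_add_right cinner_commute complex_cnj_add)

lemma cinner_scaleC_left: "cinner (c *\<^sub>C x) y = cnj c * cinner x y"
  by (metis cinner_scaleC_right cinner_commute complex_cnj_mult)

lemma cinner_minus_right: "cinner x (- y) = - cinner x y"
  using cinner_scaleC_right[of x "- 1" y] by (simp add: cvec.scale_minus_left scaleC_one)

lemma cinner_minus_left: "cinner (- x) y = - cinner x y"
  using cinner_scaleC_left[of "- 1" x y] by (simp add: cvec.scale_minus_left scaleC_one)

lemma norm_add_square: "(norm (x + y))\<^sup>2 = (norm x)\<^sup>2 + (norm y)\<^sup>2 + 2 * Re (cinner x y)"
proof -
  have "cinner (x + y) (x + y) = cinner x x + cinner y y + (cinner x y + cnj (cinner x y))"
    by (simp add: cinner_add_left cinner_add_right flip: cinner_commute)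
  from arg_cong[OF this, of Re] show ?thesis by (simp add: cinner_self)
qed

lemma norm_diff_square: "(norm (x - y))\<^sup>2 = (norm x)\<^sup>2 + (norm y)\<^sup>2 - 2 * Re (cinner x y)"
  using norm_add_square[of x "- y"] by (simp add: cinner_minus_right)

lemma Re_cinner_self: "Re (cinner x x) = (norm x)\<^sup>2"
  by (simp add: cinner_self)

lemma Re_cinner_commute: "Re (cinner x y) = Re (cinner y x)"
  by (metis cinner_commute cnj.simps(1))

lemma Re_cinner_scaleR_right: "Re (cinner x (r *\<^sub>R y)) = r * Re (cinner x y)"
  by (simp add: scaleR_eq_scaleC cinner_scaleC_right)

text \<open>Polarization expresses the real part of the inner product by norms, so that continuity of the norm
  suffices.\<close>

lemma tendsto_Re_cinner:
  assumes "X \<longlonglongrightarrow> x"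
  shows "(\<lambda>n. Re (cinner (X n) w)) \<longlonglongrightarrow> Re (cinner x w)"
proof -
  have eq: "Re (cinner x w) = ((norm (x + w))\<^sup>2 - (norm x)\<^sup>2 - (norm w)\<^sup>2) / 2" for x
    by (simp add: norm_add_square)
  have "(\<lambda>n. ((norm (X n + w))\<^sup>2 - (norm (X n))\<^sup>2 - (norm w)\<^sup>2) / 2)
      \<longlonglongrightarrow> ((norm (x + w))\<^sup>2 - (norm x)\<^sup>2 - (norm w)\<^sup>2) / 2"
    by (rule tendsto_divide[OF tendsto_diff[OF tendsto_diff] tendsto_const])
       (auto intro!: tendsto_power tendsto_norm tendsto_add assms)
  then show ?thesis by (simp only: eq)
qed

lemma eq_if_Re_cinner_eq:
  assumes "\<And>w. Re (cinner x w) = Re (cinner y w)"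
  shows "x = y"
proof -
  have "Re (cinner (x - y) w) = 0" for w
    using assms[of w] cinner_add_left[of x "- y" w] by (simp add: cinner_minus_left)
  from this[of "x - y"] show ?thesis by (simp add: cinner_self)
qed

text \<open>The range of \<open>T\<close> contains a point nearest to a given \<open>y\<close>: by the parallelogram law the images of
  a minimizing sequence are Cauchy, by the lower bound so is the sequence itself, and the adjoint
  identifies the limit of the images as the image of the limit, in place of continuity of \<open>T\<close>. The residual is orthogonal to the range, hence in the kernel of the adjoint, hence zero.\<close>

lemma surj_if_bounded_below_adjoint_injective:
  fixes T :: "'v::complex_hilbert \<Rightarrow> 'w::complex_hilbert"
  assumes T: "linear T"
    and adjoint: "\<And>x y. Re (cinner (T x) y) = Re (cinner x (T' y))"
    and lower: "\<And>x. norm x \<le> norm (T x)"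
    and inj: "\<And>y. T' y = 0 \<Longrightarrow> y = 0"
  shows "surj T"
proof -
  have "\<exists>x. T x = y" for y
  proof -
    define d where "d = (INF x. norm (T x - y))"
    have d_le: "d \<le> norm (T x - y)" for x
      unfolding d_def by (rule cINF_lower[OF bdd_belowI[of _ 0]]) auto
    have d0: "0 \<le> d" unfolding d_def by (rule cINF_greatest) auto
    have "\<exists>x. norm (T x - y) < d + inverse (real (Suc n))" for n
      using cInf_lessD[of "range (\<lambda>x. norm (T x - y))" "d + inverse (real (Suc n))"]
      unfolding d_def by auto
    then obtain X where X: "norm (T (X n) - y) < d + inverse (real (Suc n))" for n by metis
    have parallelogram: "(norm (T a - T b))\<^sup>2
        \<le> 2 * (norm (T a - y))\<^sup>2 + 2 * (norm (T b - y))\<^sup>2 - 4 * d\<^sup>2" for a b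
    proof -
      let ?m = "(1 / 2) *\<^sub>R (a + b)"
      have eq: "(T a - y) + (T b - y) = 2 *\<^sub>R (T ?m - y)"
        by (simp add: linear_add[OF T] linear_cmul[OF T] scaleR_right_diff_distrib scaleR_2)
      have "4 * d\<^sup>2 \<le> 4 * (norm (T ?m - y))\<^sup>2"
        using d_le[of ?m] d0 by (simp add: power_mono)
      also have "\<dots> = (norm ((T a - y) + (T b - y)))\<^sup>2"
        unfolding eq by (simp add: power_mult_distrib)
      finally show ?thesis
        using norm_add_square[of "T a - y" "T b - y"] norm_diff_square[of "T a - y" "T b - y"] by simp
    qed
    define \<epsilon> where "\<epsilon> n = 4 * ((d + inverse (real (Suc n)))\<^sup>2 - d\<^sup>2)" for n
    have close: "(norm (T (X m) - T (X n)))\<^sup>2 \<le> \<epsilon> N" if "N \<le> m" "N \<le> n" for m n N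
    proof -
      have le: "(norm (T (X k) - y))\<^sup>2 \<le> (d + inverse (real (Suc N)))\<^sup>2" if "N \<le> k" for k
      proof (rule power_mono)
        have "inverse (real (Suc k)) \<le> inverse (real (Suc N))"
          using that by (intro le_imp_inverse_le) auto
        with X[of k] show "norm (T (X k) - y) \<le> d + inverse (real (Suc N))" by linarith
      qed simp
      show ?thesis
        using parallelogram[of "X m" "X n"] le[OF that(1)] le[OF that(2)] by (simp add: \<epsilon>_def)
    qed
    have lim: "(\<lambda>n. d + inverse (real (Suc n))) \<longlonglongrightarrow> d"
      using tendsto_add[OF tendsto_const LIMSEQ_inverse_real_of_nat, of d] by simp
    then have "\<epsilon> \<longlonglongrightarrow> 4 * (d\<^sup>2 - d\<^sup>2)"
      unfolding \<epsilon>_def by (intro tendsto_intros)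
    then have \<epsilon>: "\<epsilon> \<longlonglongrightarrow> 0" by simp
    have Cauchy_TX: "Cauchy (\<lambda>n. T (X n))"
    proof (rule CauchyI)
      fix e :: real assume e: "0 < e"
      then have "eventually (\<lambda>N. \<epsilon> N < e\<^sup>2) sequentially"
        by (intro order_tendstoD(2)[OF \<epsilon>]) simp
      then obtain N where "\<epsilon> N < e\<^sup>2" by (auto simp: eventually_sequentially)
      then have "\<forall>m\<ge>N. \<forall>n\<ge>N. norm (T (X m) - T (X n)) < e"
        using e close by (meson le_less_trans less_eq_real_def power_less_imp_less_base)
      then show "\<exists>N. \<forall>m\<ge>N. \<forall>n\<ge>N. norm (T (X m) - T (X n)) < e" by blast
    qed
    have "Cauchy X"
    proof (rule CauchyI)
      fix e :: real assume "0 < e"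
      then obtain N where "\<forall>m\<ge>N. \<forall>n\<ge>N. norm (T (X m) - T (X n)) < e"
        using CauchyD[OF Cauchy_TX] by blast
      then show "\<exists>N. \<forall>m\<ge>N. \<forall>n\<ge>N. norm (X m - X n) < e"
        using lower by (metis linear_diff[OF T] le_less_trans)
    qed
    then obtain x where x: "X \<longlonglongrightarrow> x" by (auto simp: Cauchy_convergent_iff convergent_def)
    obtain z where z: "(\<lambda>n. T (X n)) \<longlonglongrightarrow> z"
      using Cauchy_TX by (auto simp: Cauchy_convergent_iff convergent_def)
    have "T x = z"
    proof (rule eq_if_Re_cinner_eq)
      fix w
      have "(\<lambda>n. Re (cinner (T (X n)) w)) \<longlonglongrightarrow> Re (cinner (T x) w)"
        unfolding adjoint by (rule tendsto_Re_cinner[OF x])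
      then show "Re (cinner (T x) w) = Re (cinner z w)"
        using tendsto_Re_cinner[OF z] LIMSEQ_unique by blast
    qed
    have "norm (T x - y) \<le> d"
    proof (rule LIMSEQ_le[OF _ lim])
      show "(\<lambda>n. norm (T (X n) - y)) \<longlonglongrightarrow> norm (T x - y)"
        unfolding \<open>T x = z\<close> by (intro tendsto_intros z)
    qed (use X in \<open>auto intro: less_imp_le\<close>)
    then have minimal: "norm (T x - y) \<le> norm (T u - y)" for u using d_le[of u] by linarith
    define e where "e = y - T x"
    have "Re (cinner e (T u)) = 0" for u
    proof -
      \<comment> \<open>If \<open>b \<noteq> 0\<close>, moving from \<open>x\<close> by a small multiple of \<open>b u\<close> would come closer to \<open>y\<close>. The minimum of
        \<open>t\<^sup>2 a - 2 t b\<close> is at \<open>t = b / a\<close>; the denominator \<open>a + 1\<close> avoids the case \<open>a = 0\<close>.\<close>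
      define a b t where "a = (norm (T u))\<^sup>2" and "b = Re (cinner e (T u))" and "t = b / (a + 1)"
      have a: "0 \<le> a" by (simp add: a_def)
      have "(norm e)\<^sup>2 \<le> (norm (e - T (t *\<^sub>R u)))\<^sup>2"
        using minimal[of "x + t *\<^sub>R u"]
        by (intro power_mono) (simp_all add: e_def linear_add[OF T] norm_minus_commute algebra_simps)
      also have "\<dots> = (norm e)\<^sup>2 + t\<^sup>2 * a - 2 * t * b"
        by (simp add: norm_diff_square linear_cmul[OF T] power_mult_distrib a_def b_def
            Re_cinner_scaleR_right)
      finally have "0 \<le> t\<^sup>2 * a - 2 * t * b" by simp
      moreover have "b = t * (a + 1)" using a by (simp add: t_def)
      ultimately have "t\<^sup>2 * (a + 2) \<le> 0" by (simp add: power2_eq_square algebra_simps)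
      then have "t = 0" using a by (simp add: mult_le_0_iff)
      with \<open>b = t * (a + 1)\<close> show ?thesis by (simp add: b_def)
    qed
    then have "Re (cinner (T' e) u) = 0" for u
      by (metis adjoint Re_cinner_commute)
    then have "T' e = 0" using Re_cinner_self[of "T' e"] by simp
    then have "e = 0" by (rule inj)
    then show ?thesis by (auto simp: e_def)
  qed
  then show ?thesis unfolding surj_def by metis
qed

section \<open>The linear and antilinear parts of a symplectic automorphism\<close>

lemma symplectic_form_cstruct_right: "symplectic_form x (cstruct y) = Re (cinner x y)"
  and symplectic_form_cstruct_left: "symplectic_form (cstruct x) y = - Re (cinner x y)"
  by (simp_all add: symplectic_form_def cstruct_def cinner_scaleC_left cinner_scaleC_right)

lemma symplectic_form_cstruct_move: "symplectic_form (cstruct x) y = - symplectic_form x (cstruct y)"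
  by (simp add: symplectic_form_cstruct_right symplectic_form_cstruct_left)

lemma symplectic_form_cstruct2: "symplectic_form (cstruct x) (cstruct y) = symplectic_form x y"
  by (simp add: symplectic_form_def cstruct_def cinner_scaleC_left cinner_scaleC_right flip: mult.assoc)

lemma cstruct_cstruct: "cstruct (cstruct v) = - v"
  by (simp add: cstruct_def scaleC_scaleC scaleC_one cvec.scale_minus_left)

lemma cstruct_linear: "cstruct (x + y) = cstruct x + cstruct y" "cstruct (x - y) = cstruct x - cstruct y"
  "cstruct (- x) = - cstruct x" "cstruct (c *\<^sub>C x) = c *\<^sub>C cstruct x"
  by (simp_all add: cstruct_def scaleC_add_right cvec.scale_right_diff_distrib scaleC_scaleC mult.commute
      cvec.scale_minus_right)

lemma scaleC_eq_cstruct: "c *\<^sub>C v = Re c *\<^sub>R v + Im c *\<^sub>R cstruct (v :: 'v::complex_hilbert)"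
proof -
  have "Re c *\<^sub>R v + Im c *\<^sub>R cstruct v = (of_real (Re c) + \<i> * of_real (Im c)) *\<^sub>C v"
    by (simp only: cstruct_def scaleR_eq_scaleC scaleC_scaleC scaleC_add_left mult.commute)
  then show ?thesis by (simp flip: complex_eq)
qed

lemma scaleR_cstruct: "cstruct (r *\<^sub>R v) = r *\<^sub>R cstruct (v :: 'v::complex_hilbert)"
  by (simp add: cstruct_linear scaleR_eq_scaleC)

lemma symplectic_form_linear:
  "symplectic_form (x + y) z = symplectic_form x z + symplectic_form y z"
  "symplectic_form z (x + y) = symplectic_form z x + symplectic_form z y"
  "symplectic_form (x - y) z = symplectic_form x z - symplectic_form y z"
  "symplectic_form z (x - y) = symplectic_form z x - symplectic_form z y"
  "symplectic_form (- x) z = - symplectic_form x z"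
  "symplectic_form z (- x) = - symplectic_form z x"
  "symplectic_form (r *\<^sub>R x) z = r * symplectic_form x z"
  "symplectic_form z (r *\<^sub>R x) = r * symplectic_form z x"
  using cinner_add_left[of x "- y" z] cinner_add_right[of z x "- y"]
  by (simp_all add: symplectic_form_def cinner_add_left cinner_add_right cinner_minus_left
      cinner_minus_right scaleR_eq_scaleC cinner_scaleC_left cinner_scaleC_right)

lemma C_part_real: "C_part g v = (1 / 2) *\<^sub>R (g v - cstruct (g (cstruct v)))"
  for g :: "'v::complex_hilbert \<Rightarrow> 'v"
  by (simp add: C_part_def scaleR_eq_scaleC)

lemma A_part_real: "A_part g v = (1 / 2) *\<^sub>R (g v + cstruct (g (cstruct v)))"
  for g :: "'v::complex_hilbert \<Rightarrow> 'v"
  by (simp add: A_part_def scaleR_eq_scaleC)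

lemma
  fixes g :: "'v::complex_hilbert \<Rightarrow> 'v"
  assumes g: "linear g"
  shows clinear_C_part: "clinear (C_part g)"
    and A_part_scaleC: "A_part g (c *\<^sub>C x) = cnj c *\<^sub>C A_part g x"
    and C_part_plus_A_part: "C_part g x + A_part g x = g x"
proof -
  note lin = linear_add[OF g] linear_cmul[OF g] linear_neg[OF g]
  have add: "C_part g (x + y) = C_part g x + C_part g y" for x y
    by (simp add: C_part_real lin cstruct_linear algebra_simps)
  have addA: "A_part g (x + y) = A_part g x + A_part g y" for x y
    by (simp add: A_part_real lin cstruct_linear algebra_simps)
  have R: "C_part g (r *\<^sub>R x) = r *\<^sub>R C_part g x" "A_part g (r *\<^sub>R x) = r *\<^sub>R A_part g x" for r x
    by (simp_all add: C_part_real A_part_real lin scaleR_cstruct algebra_simps)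
  have J: "C_part g (cstruct x) = cstruct (C_part g x)" "A_part g (cstruct x) = - cstruct (A_part g x)" for x
    by (simp_all add: C_part_real A_part_real lin cstruct_linear cstruct_cstruct scaleR_cstruct algebra_simps)
  show "clinear (C_part g)"
    by (rule clinearI) (simp_all add: add R J scaleC_eq_cstruct)
  show "A_part g (c *\<^sub>C x) = cnj c *\<^sub>C A_part g x"
    by (simp add: addA R J scaleC_eq_cstruct)
  show "C_part g x + A_part g x = g x"
    by (simp add: C_part_real A_part_real scaleR_2[symmetric] flip: scaleR_add_right)
qed

context
  fixes g :: "'v::complex_hilbert \<Rightarrow> 'v"
  assumes g: "g \<in> Sp"
begin

lemma Sp_linear: "linear g" and Sp_bij: "bij g"
  and Sp_form: "symplectic_form (g x) (g y) = symplectic_form x y"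
  using g by (auto simp: Sp_def)

lemma C_part_cstruct: "C_part g (cstruct x) = cstruct (C_part g x)"
  by (simp add: cstruct_def clinear_scaleC[OF clinear_C_part[OF Sp_linear]])

lemma A_part_cstruct: "A_part g (cstruct x) = - cstruct (A_part g x)"
  by (simp add: cstruct_def A_part_scaleC[OF Sp_linear] cvec.scale_minus_left)

text \<open>Replacing \<open>(x, y)\<close> by \<open>(Jx, Jy)\<close> leaves \<open>\<Omega>(x, y)\<close> unchanged but, after cancelling \<open>J\<close>, replaces \<open>A\<^sub>g\<close> by
  \<open>- A\<^sub>g\<close> in \<open>\<Omega>(C\<^sub>g x + A\<^sub>g x, C\<^sub>g y + A\<^sub>g y)\<close>. So the terms even and odd in \<open>A\<^sub>g\<close> can be separated.\<close>

lemma
  shows Sp_form_diagonal: "symplectic_form (C_part g x) (C_part g y)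
      + symplectic_form (A_part g x) (A_part g y) = symplectic_form x y"
    and Sp_form_mixed: "symplectic_form (C_part g x) (A_part g y)
      + symplectic_form (A_part g x) (C_part g y) = 0"
proof -
  have "symplectic_form (C_part g x + A_part g x) (C_part g y + A_part g y) = symplectic_form x y" for x y
    by (simp add: C_part_plus_A_part[OF Sp_linear] Sp_form)
  note split = this[unfolded symplectic_form_linear]
  have plus: "symplectic_form (C_part g x) (C_part g y) + symplectic_form (C_part g x) (A_part g y)
      + (symplectic_form (A_part g x) (C_part g y) + symplectic_form (A_part g x) (A_part g y))
      = symplectic_form x y"
    using split[of x y] by linarith
  have minus: "symplectic_form (C_part g x) (C_part g y) - symplectic_form (C_part g x) (A_part g y)
      - symplectic_form (A_part g x) (C_part g y) + symplectic_form (A_part g x) (A_part g y)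
      = symplectic_form x y"
    using split[of "cstruct x" "cstruct y"]
    unfolding C_part_cstruct A_part_cstruct symplectic_form_linear symplectic_form_cstruct2 by linarith
  show "symplectic_form (C_part g x) (C_part g y)
      + symplectic_form (A_part g x) (A_part g y) = symplectic_form x y"
    using plus minus by linarith
  show "symplectic_form (C_part g x) (A_part g y) + symplectic_form (A_part g x) (C_part g y) = 0"
    using plus minus by linarith
qed

lemma norm_C_part: "(norm (C_part g x))\<^sup>2 = (norm x)\<^sup>2 + (norm (A_part g x))\<^sup>2"
  using Sp_form_diagonal[of x "cstruct x"]
  unfolding C_part_cstruct A_part_cstruct symplectic_form_linear symplectic_form_cstruct_right
    Re_cinner_self by linarith

lemma norm_le_norm_C_part: "norm x \<le> norm (C_part g x)"
proof (rule power2_le_imp_le[OF _ norm_ge_zero])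
  show "(norm x)\<^sup>2 \<le> (norm (C_part g x))\<^sup>2"
    unfolding norm_C_part by simp
qed

text \<open>The mixed identity is the imaginary part of the claim; replacing \<open>x\<close> by \<open>Jx\<close> in it gives the real
  part.\<close>

lemma C_A_symmetric: "cinner (C_part g x) (A_part g y) = cinner (C_part g y) (A_part g x)"
proof (rule complex_eqI)
  have swap: "symplectic_form u v = - symplectic_form v u" for u v :: 'v
    unfolding symplectic_form_def by (metis cinner_commute cnj.simps(2))
  show "Im (cinner (C_part g x) (A_part g y)) = Im (cinner (C_part g y) (A_part g x))"
    using Sp_form_mixed[of x y] swap[of "A_part g x" "C_part g y"] by (simp add: symplectic_form_def)
  show "Re (cinner (C_part g x) (A_part g y)) = Re (cinner (C_part g y) (A_part g x))"
    using Sp_form_mixed[of "cstruct x" y] swap[of "A_part g (cstruct x)" "C_part g y"]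
    by (simp add: C_part_cstruct A_part_cstruct symplectic_form_linear symplectic_form_cstruct_right
        symplectic_form_cstruct_left)
qed

lemma Sp_inv: "inv g \<in> Sp"
proof -
  have g_inv: "g (inv g x) = x" and inv_g: "inv g (g x) = x" for x
    using Sp_bij by (simp_all add: bij_is_surj surj_f_inv_f bij_is_inj)
  have "linear (inv g)"
  proof (rule linearI)
    show "inv g (x + y) = inv g x + inv g y" for x y
      using inv_g[of "inv g x + inv g y"] by (simp add: linear_add[OF Sp_linear] g_inv)
    show "inv g (r *\<^sub>R x) = r *\<^sub>R inv g x" for r x
      using inv_g[of "r *\<^sub>R inv g x"] by (simp add: linear_cmul[OF Sp_linear] g_inv)
  qed
  then show ?thesis
    using Sp_bij Sp_form[of "inv g x" "inv g y" for x y]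
    by (simp add: Sp_def bij_imp_bij_inv g_inv)
qed

text \<open>With respect to \<open>\<Omega>\<close> the adjoint of \<open>g\<close> is \<open>g\<^sup>-\<^sup>1\<close> and the adjoint of \<open>J\<close> is \<open>- J\<close>, so that of
  \<open>g - J g J\<close> is \<open>g\<^sup>-\<^sup>1 - J g\<^sup>-\<^sup>1 J\<close>; and \<open>Re \<langle>x|y\<rangle> = \<Omega>(x, Jy)\<close>.\<close>

lemma C_part_adjoint: "Re (cinner (C_part g x) y) = Re (cinner x (C_part (inv g) y))"
proof -
  have adj: "symplectic_form (g x) y = symplectic_form x (inv g y)" for x y
    using Sp_form[of x "inv g y"] Sp_bij by (simp add: bij_is_surj surj_f_inv_f)
  have "symplectic_form (C_part g x) y = symplectic_form x (C_part (inv g) y)" for x y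
    by (simp add: C_part_real symplectic_form_linear symplectic_form_cstruct_move adj)
  note this[of x "cstruct y"]
  moreover have "C_part (inv g) (cstruct y) = cstruct (C_part (inv g) y)"
    using Sp_inv by (simp add: cstruct_def clinear_scaleC[OF clinear_C_part] Sp_def)
  ultimately show ?thesis by (simp add: symplectic_form_cstruct_right)
qed

end

lemma bij_C_part:
  assumes g: "g \<in> Sp"
  shows "bij (C_part g)"
proof -
  have lin: "linear (C_part g)"
    by (rule linearI) (simp_all add: clinear_add[OF clinear_C_part[OF Sp_linear[OF g]]]
        clinear_scaleC[OF clinear_C_part[OF Sp_linear[OF g]]] scaleR_eq_scaleC)
  have inj: "x = 0" if "h \<in> Sp" "C_part h x = 0" for h and x :: 'a
    using norm_le_norm_C_part[OF that(1), of x] that(2) by simp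
  have "surj (C_part g)"
    by (rule surj_if_bounded_below_adjoint_injective[OF lin C_part_adjoint[OF g]
          norm_le_norm_C_part[OF g] inj[OF Sp_inv[OF g]]])
  moreover have "inj (C_part g)"
    using inj[OF g] by (simp add: linear_injective_0[OF lin])
  ultimately show ?thesis by (simp add: bij_def)
qed

section \<open>Generalized Fock vacua\<close>

lemma annihilator_add: "annihilator (v + w) \<theta> = annihilator v \<theta> + annihilator w \<theta>"
proof -
  have "annihilating_derivation (v + w) (\<lambda>\<theta>. annihilator v \<theta> + annihilator w \<theta>)"
    unfolding annihilating_derivation_def
    by (auto intro!: clinearI simp: clinear_add[OF clinear_annihilator] clinear_scaleC[OF clinear_annihilator]
        scaleC_add_right annihilator_times annihilator_one annihilator_gen cinner_add_left scaleC_add_left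
        algebra_simps)
  from annihilating_derivation_unique[OF annihilator this] show ?thesis by (rule fun_cong)
qed

lemma annihilator_scaleC: "annihilator (c *\<^sub>C v) \<theta> = cnj c *\<^sub>C annihilator v \<theta>"
proof -
  have "annihilating_derivation (c *\<^sub>C v) (\<lambda>\<theta>. cnj c *\<^sub>C annihilator v \<theta>)"
    unfolding annihilating_derivation_def
    by (auto intro!: clinearI simp: clinear_add[OF clinear_annihilator] clinear_scaleC[OF clinear_annihilator]
        scaleC_add_right annihilator_times annihilator_one annihilator_gen cinner_scaleC_left
        scaleC_scaleC scaleC_mult_left scaleC_mult_right mult.commute)
  from annihilating_derivation_unique[OF annihilator this] show ?thesis by (rule fun_cong)
qed

lemma
  assumes "antilinear \<Phi>"
  shows dual_annihilator_vector_add: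
      "dual_annihilator (v + w) \<Phi> \<psi> = dual_annihilator v \<Phi> \<psi> + dual_annihilator w \<Phi> \<psi>"
    and dual_annihilator_vector_scaleC:
      "dual_annihilator (c *\<^sub>C v) \<Phi> \<psi> = cnj c * dual_annihilator v \<Phi> \<psi>"
    and dual_creator_vector_add:
      "dual_creator (v + w) \<Phi> \<psi> = dual_creator v \<Phi> \<psi> + dual_creator w \<Phi> \<psi>"
    and dual_creator_vector_scaleC: "dual_creator (c *\<^sub>C v) \<Phi> \<psi> = c * dual_creator v \<Phi> \<psi>"
  by (simp_all add: dual_annihilator_def dual_creator_def creator_def clinear_add[OF clinear_sym_gen]
      clinear_scaleC[OF clinear_sym_gen] distrib_right scaleC_mult_left annihilator_add
      annihilator_scaleC antilinear_add[OF assms] antilinear_scaleC[OF assms])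

text \<open>\<open>a(v)\<close> is antilinear and \<open>c(v)\<close> linear in \<open>v\<close> as operators on \<open>SV'\<close>. Hence the combination is
  \<open>a(gv - J g J v) + c(gv + J g J v)\<close> up to the factor \<open>1/\<surd>2\<close>.\<close>

lemma dual_field_vacuum_combination:
  assumes g: "g \<in> Sp" and \<Phi>: "antilinear \<Phi>"
  shows "dual_field (g v) \<Phi> \<psi> + \<i> * dual_field (g (cstruct v)) \<Phi> \<psi>
    = 2 / of_real (sqrt 2) * (dual_annihilator (C_part g v) \<Phi> \<psi> + dual_creator (A_part g v) \<Phi> \<psi>)"
proof -
  have gv: "g v = C_part g v + A_part g v"
    by (simp add: C_part_plus_A_part[OF Sp_linear[OF g]])
  have gJv: "g (cstruct v) = \<i> *\<^sub>C C_part g v + (- \<i>) *\<^sub>C A_part g v"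
  proof -
    have "g (cstruct v) = C_part g (cstruct v) + A_part g (cstruct v)"
      by (simp only: C_part_plus_A_part[OF Sp_linear[OF g]])
    also have "\<dots> = \<i> *\<^sub>C C_part g v + (- \<i>) *\<^sub>C A_part g v"
      unfolding C_part_cstruct[OF g] A_part_cstruct[OF g]
      by (simp only: cstruct_def cvec.scale_minus_left)
    finally show ?thesis .
  qed
  show ?thesis
    unfolding gv gJv dual_field_def dual_annihilator_vector_add[OF \<Phi>]
      dual_annihilator_vector_scaleC[OF \<Phi>] dual_creator_vector_add[OF \<Phi>]
      dual_creator_vector_scaleC[OF \<Phi>]
    by (simp add: algebra_simps)
qed

lemma Z_op_C_part:
  assumes "g \<in> Sp"
  shows "Z_op g (C_part g v) = - A_part g v"
  using bij_C_part[OF assms] by (simp add: Z_op_def bij_is_inj)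

lemma Z_op_symmetric:
  assumes "g \<in> Sp"
  shows "cinner y (Z_op g x) = cinner x (Z_op g y)"
proof -
  obtain u v where "x = C_part g u" "y = C_part g v"
    using bij_C_part[OF assms] by (metis bij_pointE)
  then show ?thesis
    using C_A_symmetric[OF assms, of u v] by (simp add: Z_op_C_part[OF assms] cinner_minus_right)
qed

lemma generalized_vacuum_iff:
  assumes g: "g \<in> Sp"
  shows "generalized_vacuum g \<Phi> \<longleftrightarrow> antilinear \<Phi> \<and> \<Phi> \<noteq> (\<lambda>_. 0) \<and>
    (\<forall>w. dual_annihilator w \<Phi> = dual_creator (Z_op g w) \<Phi>)"
proof (cases "antilinear \<Phi>")
  case \<Phi>: True
  have creator_neg: "dual_creator (- v) \<Phi> \<psi> = - dual_creator v \<Phi> \<psi>" for v \<psi>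
    using dual_creator_vector_scaleC[OF \<Phi>, of "- 1" v \<psi>]
    by (simp add: cvec.scale_minus_left scaleC_one)
  have "(\<forall>v \<psi>. dual_field (g v) \<Phi> \<psi> + \<i> * dual_field (g (cstruct v)) \<Phi> \<psi> = 0)
      \<longleftrightarrow> (\<forall>v. dual_annihilator (C_part g v) \<Phi> = dual_creator (Z_op g (C_part g v)) \<Phi>)"
    unfolding dual_field_vacuum_combination[OF g \<Phi>]
    by (simp add: Z_op_C_part[OF g] fun_eq_iff creator_neg add_eq_0_iff2)
  also have "\<dots> \<longleftrightarrow> (\<forall>w. dual_annihilator w \<Phi> = dual_creator (Z_op g w) \<Phi>)"
    using bij_C_part[OF g] by (metis bij_pointE)
  finally show ?thesis by (simp add: generalized_vacuum_def sym_dual_def \<Phi>)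
qed (simp add: generalized_vacuum_def sym_dual_def)

lemma quadratic_functional_gaussian_exponent:
  assumes g: "g \<in> Sp"
  shows "quadratic_functional (\<lambda>x y. cinner y (Z_op g x)) (gaussian_exponent g)"
proof -
  have "antilinear (\<lambda>y. cinner y (Z_op g x))" for x
    by (simp add: antilinear_def cinner_add_left cinner_scaleC_left)
  then obtain \<zeta> where \<zeta>: "quadratic_functional (\<lambda>x y. cinner y (Z_op g x)) \<zeta>"
    using quadratic_functional_exists[of "\<lambda>x y. cinner y (Z_op g x)"]
      Z_op_symmetric[OF g] by blast
  have "(THE \<zeta>. quadratic_functional (\<lambda>x y. cinner y (Z_op g x)) \<zeta>) = \<zeta>"
    by (intro the_equality) (rule \<zeta>, rule quadratic_functional_unique[OF _ \<zeta>])
  then have "gaussian_exponent g = \<zeta>"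
    by (simp only: gaussian_exponent_def quadratic_functional_def)
  with \<zeta> show ?thesis by simp
qed

lemma
  assumes g: "g \<in> Sp"
  shows antilinear_gaussian: "antilinear (gaussian g)"
    and gaussian_at_one: "gaussian g 1 = 1"
    and dual_annihilator_gaussian:
      "dual_annihilator w (gaussian g) = dual_creator (Z_op g w) (gaussian g)"
proof -
  note q = quadratic_functional_gaussian_exponent[OF g]
  have one: "gaussian_exponent g 1 = 0"
    using quadratic_functionalD(2)[OF q, of "{#}"] by simp
  note exp = quadratic_functionalD(1)[OF q] one dual_annihilator_quadratic[OF q]
  show "antilinear (gaussian g)" "gaussian g 1 = 1"
      "dual_annihilator w (gaussian g) = dual_creator (Z_op g w) (gaussian g)"
    unfolding gaussian_def
    by (rule antilinear_dual_exp[OF exp] dual_exp_at_one[OF exp] dual_annihilator_exp[OF exp])+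
qed

theorem theorem3p9:
  fixes g :: "'v::complex_hilbert \<Rightarrow> 'v"
  assumes "g \<in> Sp"
  shows "{\<Phi>. generalized_vacuum g \<Phi>} = {\<lambda>\<theta>. c * gaussian g \<theta> | c. c \<noteq> 0}"
proof (intro equalityI subsetI; clarsimp)
  note G = antilinear_gaussian[OF assms] gaussian_at_one[OF assms]
  fix \<Phi> assume "generalized_vacuum g \<Phi>"
  then have \<Phi>: "antilinear \<Phi>" "\<Phi> \<noteq> (\<lambda>_. 0)"
    and eq: "dual_annihilator w \<Phi> = dual_creator (Z_op g w) \<Phi>" for w
    by (simp_all add: generalized_vacuum_iff[OF assms])
  \<comment> \<open>The solution of the same equation with value \<open>0\<close> at \<open>1\<close>.\<close>
  define \<Psi> where "\<Psi> = (\<lambda>\<theta>. (- \<Phi> 1) * gaussian g \<theta> + \<Phi> \<theta>)"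
  have vanish: "\<Psi> = (\<lambda>_. 0)"
  proof (rule gaussian_equation_determined)
    show "antilinear \<Psi>" unfolding \<Psi>_def by (rule antilinear_combination[OF G(1) \<Phi>(1)])
    show "dual_annihilator w \<Psi> = dual_creator (Z_op g w) \<Psi>" for w
    proof
      show "dual_annihilator w \<Psi> \<theta> = dual_creator (Z_op g w) \<Psi> \<theta>" for \<theta>
        using fun_cong[OF eq[of w], of \<theta>] fun_cong[OF dual_annihilator_gaussian[OF assms, of w], of \<theta>]
        unfolding \<Psi>_def dual_annihilator_def dual_creator_def by simp
    qed
    show "\<Psi> 1 = 0" by (simp add: \<Psi>_def G(2))
  qed
  have scalar: "\<Phi> \<theta> = \<Phi> 1 * gaussian g \<theta>" for \<theta>
    using fun_cong[OF vanish, of \<theta>] unfolding \<Psi>_def by simp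
  have "\<Phi> 1 \<noteq> 0"
  proof
    assume "\<Phi> 1 = 0"
    then have "\<Phi> \<theta> = 0" for \<theta> using scalar[of \<theta>] by (simp only: mult_zero_left)
    with \<Phi>(2) show False by blast
  qed
  with scalar show "\<exists>c. \<Phi> = (\<lambda>\<theta>. c * gaussian g \<theta>) \<and> c \<noteq> 0" by blast
next
  fix c :: complex assume c: "c \<noteq> 0"
  have "(\<lambda>\<theta>. c * gaussian g \<theta>) \<noteq> (\<lambda>_. 0)"
  proof
    assume "(\<lambda>\<theta>. c * gaussian g \<theta>) = (\<lambda>_. 0)"
    from fun_cong[OF this, of 1] c show False by (simp add: gaussian_at_one[OF assms])
  qed
  moreover have "dual_annihilator w (\<lambda>\<theta>. c * gaussian g \<theta>)
      = dual_creator (Z_op g w) (\<lambda>\<theta>. c * gaussian g \<theta>)" for w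
  proof
    show "dual_annihilator w (\<lambda>\<theta>. c * gaussian g \<theta>) \<theta>
        = dual_creator (Z_op g w) (\<lambda>\<theta>. c * gaussian g \<theta>) \<theta>" for \<theta>
      using fun_cong[OF dual_annihilator_gaussian[OF assms, of w], of \<theta>]
      unfolding dual_annihilator_def dual_creator_def by simp
  qed
  ultimately show "generalized_vacuum g (\<lambda>\<theta>. c * gaussian g \<theta>)"
    using antilinear_scale[OF antilinear_gaussian[OF assms]]
    by (simp only: generalized_vacuum_iff[OF assms]) simp
qed

end
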